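(* Let $G$ be a compact Lie group with Lie algebra $\mathfrak g$ acting by quaternionic isometries on a quaternion-Kähler manifold $M$ with moment map $\mu=\sum_{i=1}^3 I_i\otimes B_i$, where $B_i=\lambda v_i$ with $(v_1,v_2,v_3)$ an orthonormal basis of $V=\Psi(x)$ and $\lambda>0$ a differentiable $G$-invariant function, and let $\Psi:M_0\to\mathbb{G}_3(\mathfrak g)$ be the induced map. Let $x\in M_0$ and let $Y\in T_xM$ be such that $$\Psi_*Y=\sum_{i=1}^3 v_i\otimes p_i,\qquad p_i\in V^\perp,\ V=\Psi(x).$$ Then $$(Y)^{\natural}=\frac1\lambda\sum_{i=1}^3 I_i\,\tilde p_i ,$$ where $\tilde p_i$ is the value at $x$ of the Killing vector field on $M$ generated by $p_i\in\mathfrak g$.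
   Context: $M$ is a connected quaternion-Kähler (QK) manifold with nonzero scalar curvature. $S^2H$ denotes the real rank 3 bundle of endomorphisms of $TM$ locally spanned by almost complex structures $I_1,I_2,I_3$, compatible with the metric, with $I_i^2=-\mathrm{Id}$, $I_iI_j=I_k$ for $(i,j,k)$ cyclic; it is preserved by the Levi-Civita connection $\nabla$. $G$ acts by isometries preserving the QK structure; $\tilde A$ is the Killing field on $M$ generated by $A\in\mathfrak g$. $\mathfrak g$ has the inner product given by minus the Killing form (assumed positive definite). The moment map is the section $\mu$ of $S^2H\otimes\mathfrak g$ whose contractions $\mu_A=\langle\mu,A\rangle$ satisfy $\nabla\mu_A=\sum_{i=1}^3 (I_i\tilde A)^\flat\otimes I_i$ (the constant factor, the scalar curvature, is normalized to $1$). Locally $\mu=\sum_i I_i\otimes B_i$ with $B_i$ $\mathfrak g$-valued; $M_0\subset M$ is the set of points where $B_1,B_2,B_3$ are linearly independent, and $\Psi(x)$ is the oriented 3-plane $\mathrm{span}\{B_1(x),B_2(x),B_3(x)\}$. $\mathbb{G}_3(\mathfrak g)$ is the Grassmannian of oriented 3-planes in $\mathfrak g$, with $T_V\mathbb{G}_3(\mathfrak g)=\mathrm{Hom}(V,V^\perp)\cong V\otimes V^\perp$ and Riemannian metric the tensor product metric. $\flat$ and $\sharp$ denote the musical isomorphisms of the respective Riemannian metrics. The endomorphism $\natural$ of $T_xM$ is defined by $$(X)^\natural=\bigl(\Psi^*\bigl((\Psi_*X)^\flat\bigr)\bigr)^\sharp,$$ with $\flat$ taken on $\mathbb{G}_3(\mathfrak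 g)$ and $\sharp$ on $M$. *)

theory Defs
  imports
    "HOL-Analysis.Analysis"
    "HOL-Algebra.Group_Action"
    "HOL-Library.Function_Algebras"
    "HOL-Library.Numeral_Type"
begin

text \<open>
  Manifolds are whole types, equipped with an atlas of charts \<open>(U, \<phi>)\<close> valued in a Euclidean
  space. Tangent vectors at a point are derivations on germs of smooth real functions, so they are
  elements of the real vector space of functions from \<open>'m \<Rightarrow> real\<close> to \<open>real\<close>.
\<close>

instantiation "fun" :: (type, real_vector) real_vector
begin

definition scaleR_fun :: "real \<Rightarrow> ('a \<Rightarrow> 'b) \<Rightarrow> 'a \<Rightarrow> 'b"
  where "scaleR_fun c f = (\<lambda>x. c *\<^sub>R f x)"

instance
  by standard (auto simp: scaleR_fun_def fun_eq_iff scaleR_add_left scaleR_add_right)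

end

lemma scaleR_fun_apply [simp]: "(c *\<^sub>R f) x = c *\<^sub>R f x" for f :: "'a \<Rightarrow> 'b::real_vector"
  by (simp add: scaleR_fun_def)


section \<open>Smooth manifolds\<close>

text \<open>The next two definitions are meant for open sets \<open>S\<close>.\<close>

fun Ck_on :: "nat \<Rightarrow> 'a::euclidean_space set \<Rightarrow> ('a \<Rightarrow> 'b::euclidean_space) \<Rightarrow> bool" where
  "Ck_on 0 S f \<longleftrightarrow> continuous_on S f"
| "Ck_on (Suc k) S f \<longleftrightarrow>
     (\<exists>f'. (\<forall>x\<in>S. (f has_derivative f' x) (at x)) \<and> (\<forall>v. Ck_on k S (\<lambda>x. f' x v)))"

definition smooth_on :: "'a::euclidean_space set \<Rightarrow> ('a \<Rightarrow> 'b::euclidean_space) \<Rightarrow> bool" where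
  "smooth_on S f \<longleftrightarrow> (\<forall>k. Ck_on k S f)"

type_synonym ('m, 'e) atlas = "('m set \<times> ('m \<Rightarrow> 'e)) set"

definition smooth_atlas ::
  "('m::{t2_space, second_countable_topology}, 'e::euclidean_space) atlas \<Rightarrow> bool" where
  "smooth_atlas \<A> \<longleftrightarrow>
     (\<Union>(U, \<phi>)\<in>\<A>. U) = UNIV \<and>
     (\<forall>(U, \<phi>)\<in>\<A>. open U \<and> open (\<phi> ` U) \<and> homeomorphism U (\<phi> ` U) \<phi> (inv_into U \<phi>)) \<and>
     (\<forall>(U, \<phi>)\<in>\<A>. \<forall>(V, \<psi>)\<in>\<A>. smooth_on (\<phi> ` (U \<inter> V)) (\<psi> \<circ> inv_into U \<phi>))"

definition smooth_fun_on ::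
  "('m::topological_space, 'e::euclidean_space) atlas \<Rightarrow> 'm set \<Rightarrow> ('m \<Rightarrow> 'b::euclidean_space) \<Rightarrow> bool" where
  "smooth_fun_on \<A> W f \<longleftrightarrow> (\<forall>(U, \<phi>)\<in>\<A>. smooth_on (\<phi> ` (U \<inter> W)) (f \<circ> inv_into U \<phi>))"

definition smooth_near ::
  "('m::topological_space, 'e::euclidean_space) atlas \<Rightarrow> 'm \<Rightarrow> ('m \<Rightarrow> 'b::euclidean_space) \<Rightarrow> bool" where
  "smooth_near \<A> x f \<longleftrightarrow> (\<exists>W. open W \<and> x \<in> W \<and> smooth_fun_on \<A> W f)"

definition differentiable_fun_on ::
  "('m::topological_space, 'e::euclidean_space) atlas \<Rightarrow> 'm set \<Rightarrow> ('m \<Rightarrow> real) \<Rightarrow> bool" where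
  "differentiable_fun_on \<A> W f \<longleftrightarrow>
     (\<forall>(U, \<phi>)\<in>\<A>. (f \<circ> inv_into U \<phi>) differentiable_on (\<phi> ` (U \<inter> W)))"

definition smooth_map ::
  "('m::topological_space, 'e::euclidean_space) atlas \<Rightarrow>
   ('n::topological_space, 'f::euclidean_space) atlas \<Rightarrow> ('m \<Rightarrow> 'n) \<Rightarrow> bool" where
  "smooth_map \<A> \<B> F \<longleftrightarrow> continuous_on UNIV F \<and>
     (\<forall>(U, \<phi>)\<in>\<A>. \<forall>(V, \<psi>)\<in>\<B>. smooth_on (\<phi> ` (U \<inter> F -` V)) (\<psi> \<circ> F \<circ> inv_into U \<phi>))"

definition product_atlas ::
  "('m, 'e) atlas \<Rightarrow> ('n, 'f) atlas \<Rightarrow> ('m \<times> 'n, 'e \<times> 'f) atlas" where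
  "product_atlas \<A> \<B> = {(U \<times> V, map_prod \<phi> \<psi>) | U \<phi> V \<psi>. (U, \<phi>) \<in> \<A> \<and> (V, \<psi>) \<in> \<B>}"


section \<open>Tangent vectors and vector fields\<close>

type_synonym 'm tvec = "('m \<Rightarrow> real) \<Rightarrow> real"

text \<open>
  Since functions need only be smooth near \<open>x\<close>, locality of derivations is automatic: a function
  vanishing near \<open>x\<close> is its own product with the indicator of the complement of a neighbourhood.
\<close>

definition tangent_space ::
  "('m::topological_space, 'e::euclidean_space) atlas \<Rightarrow> 'm \<Rightarrow> 'm tvec set" where
  "tangent_space \<A> x = {D.
     (\<forall>f. \<not> smooth_near \<A> x f \<longrightarrow> D f = 0) \<and>
     (\<forall>f h. smooth_near \<A> x f \<longrightarrow> smooth_near \<A> x h \<longrightarrow> D (\<lambda>y. f y + h y) = D f + D h) \<and>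
     (\<forall>c f. smooth_near \<A> x f \<longrightarrow> D (\<lambda>y. c * f y) = c * D f) \<and>
     (\<forall>f h. smooth_near \<A> x f \<longrightarrow> smooth_near \<A> x h \<longrightarrow>
        D (\<lambda>y. f y * h y) = f x * D h + h x * D f)}"

text \<open>Derivative of a function with values in a Euclidean space along a tangent vector.\<close>

definition deriv_along :: "'m tvec \<Rightarrow> ('m \<Rightarrow> 'b::euclidean_space) \<Rightarrow> 'b" where
  "deriv_along X F = (\<Sum>b\<in>Basis. X (\<lambda>y. F y \<bullet> b) *\<^sub>R b)"

text \<open>The differential at \<open>x\<close> of a map \<open>F\<close> into the manifold with atlas \<open>\<B>\<close>.\<close>

definition differential ::
  "('n::topological_space, 'f::euclidean_space) atlas \<Rightarrow> ('m \<Rightarrow> 'n) \<Rightarrow> 'm \<Rightarrow> 'm tvec \<Rightarrow> 'n tvec" where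
  "differential \<B> F x D = (\<lambda>f. if smooth_near \<B> (F x) f then D (f \<circ> F) else 0)"

definition smooth_vf_on ::
  "('m::topological_space, 'e::euclidean_space) atlas \<Rightarrow> 'm set \<Rightarrow> ('m \<Rightarrow> 'm tvec) \<Rightarrow> bool" where
  "smooth_vf_on \<A> W X \<longleftrightarrow> (\<forall>y\<in>W. X y \<in> tangent_space \<A> y) \<and>
     (\<forall>W' f. open W' \<longrightarrow> W' \<subseteq> W \<longrightarrow> smooth_fun_on \<A> W' f \<longrightarrow> smooth_fun_on \<A> W' (\<lambda>y. X y f))"

definition smooth_vf_near ::
  "('m::topological_space, 'e::euclidean_space) atlas \<Rightarrow> 'm \<Rightarrow> ('m \<Rightarrow> 'm tvec) \<Rightarrow> bool" where
  "smooth_vf_near \<A> x X \<longleftrightarrow> (\<exists>W. open W \<and> x \<in> W \<and> smooth_vf_on \<A> W X)"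

definition vf_bracket ::
  "('m::topological_space, 'e::euclidean_space) atlas \<Rightarrow>
   ('m \<Rightarrow> 'm tvec) \<Rightarrow> ('m \<Rightarrow> 'm tvec) \<Rightarrow> 'm \<Rightarrow> 'm tvec" where
  "vf_bracket \<A> X Y x =
     (\<lambda>f. if smooth_near \<A> x f then X x (\<lambda>y. Y y f) - Y x (\<lambda>y. X y f) else 0)"


section \<open>Riemannian metrics, Levi-Civita connection, scalar curvature\<close>

type_synonym 'm metric_tensor = "'m \<Rightarrow> 'm tvec \<Rightarrow> 'm tvec \<Rightarrow> real"

definition riemannian_metric ::
  "('m::topological_space, 'e::euclidean_space) atlas \<Rightarrow> 'm metric_tensor \<Rightarrow> bool" where
  "riemannian_metric \<A> g \<longleftrightarrow>
     (\<forall>x. \<forall>u\<in>tangent_space \<A> x. \<forall>v\<in>tangent_space \<A> x. \<forall>w\<in>tangent_space \<A> x. \<forall>c.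
        g x (u + v) w = g x u w + g x v w \<and> g x (c *\<^sub>R u) w = c * g x u w \<and> g x u v = g x v u) \<and>
     (\<forall>x. \<forall>u\<in>tangent_space \<A> x. u \<noteq> 0 \<longrightarrow> g x u u > 0) \<and>
     (\<forall>W X Y. open W \<longrightarrow> smooth_vf_on \<A> W X \<longrightarrow> smooth_vf_on \<A> W Y \<longrightarrow>
        smooth_fun_on \<A> W (\<lambda>y. g y (X y) (Y y)))"

definition sharp ::
  "('m::topological_space, 'e::euclidean_space) atlas \<Rightarrow> 'm metric_tensor \<Rightarrow> 'm \<Rightarrow>
   ('m tvec \<Rightarrow> real) \<Rightarrow> 'm tvec" where
  "sharp \<A> g x \<alpha> = (THE Z. Z \<in> tangent_space \<A> x \<and> (\<forall>X\<in>tangent_space \<A> x. g x Z X = \<alpha> X))"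

text \<open>
  A connection maps a point \<open>x\<close>, a tangent vector \<open>v\<close> at \<open>x\<close> and a vector field \<open>Y\<close> smooth near \<open>x\<close>
  to the covariant derivative of \<open>Y\<close> along \<open>v\<close>.
\<close>

type_synonym 'm connection = "'m \<Rightarrow> 'm tvec \<Rightarrow> ('m \<Rightarrow> 'm tvec) \<Rightarrow> 'm tvec"

definition affine_connection ::
  "('m::topological_space, 'e::euclidean_space) atlas \<Rightarrow> 'm connection \<Rightarrow> bool" where
  "affine_connection \<A> nab \<longleftrightarrow>
     (\<forall>x. \<forall>v\<in>tangent_space \<A> x. \<forall>w\<in>tangent_space \<A> x. \<forall>c Y Z f.
        smooth_vf_near \<A> x Y \<longrightarrow> smooth_vf_near \<A> x Z \<longrightarrow> smooth_near \<A> x f \<longrightarrow>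
          nab x v Y \<in> tangent_space \<A> x \<and>
          nab x (v + w) Y = nab x v Y + nab x w Y \<and>
          nab x (c *\<^sub>R v) Y = c *\<^sub>R nab x v Y \<and>
          nab x v (\<lambda>y. Y y + Z y) = nab x v Y + nab x v Z \<and>
          nab x v (\<lambda>y. f y *\<^sub>R Y y) = v f *\<^sub>R Y x + f x *\<^sub>R nab x v Y) \<and>
     (\<forall>W X Y. open W \<longrightarrow> smooth_vf_on \<A> W X \<longrightarrow> smooth_vf_on \<A> W Y \<longrightarrow>
        smooth_vf_on \<A> W (\<lambda>y. nab y (X y) Y))"

definition levi_civita ::
  "('m::topological_space, 'e::euclidean_space) atlas \<Rightarrow> 'm metric_tensor \<Rightarrow> 'm connection \<Rightarrow> bool" where
  "levi_civita \<A> g nab \<longleftrightarrow> affine_connection \<A> nab \<and>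
     (\<forall>x X Y. smooth_vf_near \<A> x X \<longrightarrow> smooth_vf_near \<A> x Y \<longrightarrow>
        nab x (X x) Y - nab x (Y x) X = vf_bracket \<A> X Y x) \<and>
     (\<forall>x Y Z. \<forall>v\<in>tangent_space \<A> x. smooth_vf_near \<A> x Y \<longrightarrow> smooth_vf_near \<A> x Z \<longrightarrow>
        v (\<lambda>y. g y (Y y) (Z y)) = g x (nab x v Y) (Z x) + g x (Y x) (nab x v Z))"

definition curvature ::
  "('m::topological_space, 'e::euclidean_space) atlas \<Rightarrow> 'm connection \<Rightarrow>
   ('m \<Rightarrow> 'm tvec) \<Rightarrow> ('m \<Rightarrow> 'm tvec) \<Rightarrow> ('m \<Rightarrow> 'm tvec) \<Rightarrow> 'm \<Rightarrow> 'm tvec" where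
  "curvature \<A> nab X Y Z x =
     nab x (X x) (\<lambda>y. nab y (Y y) Z) - nab x (Y x) (\<lambda>y. nab y (X y) Z)
       - nab x (vf_bracket \<A> X Y x) Z"

text \<open>Frames of \<open>TM\<close> are indexed by the basis of the model space.\<close>

definition orthonormal_frame_near ::
  "('m::topological_space, 'e::euclidean_space) atlas \<Rightarrow> 'm metric_tensor \<Rightarrow> 'm \<Rightarrow>
   ('e \<Rightarrow> 'm \<Rightarrow> 'm tvec) \<Rightarrow> bool" where
  "orthonormal_frame_near \<A> g x E \<longleftrightarrow> (\<exists>W. open W \<and> x \<in> W \<and>
     (\<forall>a\<in>Basis. smooth_vf_on \<A> W (E a)) \<and>
     (\<forall>y\<in>W. \<forall>a\<in>Basis. \<forall>b\<in>Basis. g y (E a y) (E b y) = (if a = b then 1 else 0)))"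

definition scalar_curvature ::
  "('m::topological_space, 'e::euclidean_space) atlas \<Rightarrow> 'm metric_tensor \<Rightarrow> 'm connection \<Rightarrow> 'm \<Rightarrow> real" where
  "scalar_curvature \<A> g nab x = (THE s. \<forall>E. orthonormal_frame_near \<A> g x E \<longrightarrow>
     s = (\<Sum>a\<in>Basis. \<Sum>b\<in>Basis. g x (curvature \<A> nab (E a) (E b) (E b) x) (E a x)))"


section \<open>Quaternion-Kaehler manifolds\<close>

text \<open>
  Endomorphisms of a tangent space are extended by zero to all of \<^typ>\<open>'m tvec\<close>, so that they form
  a subspace of the function space and \<^const>\<open>span\<close> is available for them.
\<close>

type_synonym 'm tendo = "'m tvec \<Rightarrow> 'm tvec"

definition tangent_endos ::
  "('m::topological_space, 'e::euclidean_space) atlas \<Rightarrow> 'm \<Rightarrow> 'm tendo set" where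
  "tangent_endos \<A> x = {J.
     (\<forall>u\<in>tangent_space \<A> x. J u \<in> tangent_space \<A> x) \<and>
     (\<forall>u\<in>tangent_space \<A> x. \<forall>v\<in>tangent_space \<A> x. J (u + v) = J u + J v) \<and>
     (\<forall>c. \<forall>u\<in>tangent_space \<A> x. J (c *\<^sub>R u) = c *\<^sub>R J u) \<and>
     (\<forall>u. u \<notin> tangent_space \<A> x \<longrightarrow> J u = 0)}"

definition smooth_endo_on ::
  "('m::topological_space, 'e::euclidean_space) atlas \<Rightarrow> 'm set \<Rightarrow> ('m \<Rightarrow> 'm tendo) \<Rightarrow> bool" where
  "smooth_endo_on \<A> W J \<longleftrightarrow> (\<forall>y\<in>W. J y \<in> tangent_endos \<A> y) \<and>
     (\<forall>W' Y. open W' \<longrightarrow> W' \<subseteq> W \<longrightarrow> smooth_vf_on \<A> W' Y \<longrightarrow> smooth_vf_on \<A> W' (\<lambda>y. J y (Y y)))"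

text \<open>
  \<open>K\<close> is the covariant derivative along \<open>v\<close> of the endomorphism field \<open>J\<close>. This determines \<open>K\<close>,
  because every tangent vector at \<open>x\<close> extends to a vector field that is smooth near \<open>x\<close>.
\<close>

definition has_cov_deriv ::
  "('m::topological_space, 'e::euclidean_space) atlas \<Rightarrow> 'm connection \<Rightarrow>
   ('m \<Rightarrow> 'm tendo) \<Rightarrow> 'm \<Rightarrow> 'm tvec \<Rightarrow> 'm tendo \<Rightarrow> bool" where
  "has_cov_deriv \<A> nab J x v K \<longleftrightarrow> K \<in> tangent_endos \<A> x \<and>
     (\<forall>Y. smooth_vf_near \<A> x Y \<longrightarrow> K (Y x) = nab x v (\<lambda>y. J y (Y y)) - J x (nab x v Y))"

text \<open>
  The three almost complex structures are indexed by the integers mod 3, so that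
  \<open>(i, i + 1, i + 2)\<close> runs through the cyclic permutations of \<open>(1, 2, 3)\<close>. The set \<open>Q x\<close> is the
  fibre of \<open>S\<^sup>2H\<close> at \<open>x\<close>.
\<close>

definition quaternionic_frame ::
  "('m::topological_space, 'e::euclidean_space) atlas \<Rightarrow> 'm metric_tensor \<Rightarrow> ('m \<Rightarrow> 'm tendo set) \<Rightarrow>
   'm set \<Rightarrow> (3 \<Rightarrow> 'm \<Rightarrow> 'm tendo) \<Rightarrow> bool" where
  "quaternionic_frame \<A> g Q W I \<longleftrightarrow> open W \<and>
     (\<forall>i. smooth_endo_on \<A> W (I i)) \<and>
     (\<forall>y\<in>W. Q y = span (range (\<lambda>i. I i y))) \<and>
     (\<forall>y\<in>W. \<forall>i. \<forall>u\<in>tangent_space \<A> y.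
        I i y (I i y u) = - u \<and>
        I i y (I (i + 1) y u) = I (i + 2) y u \<and>
        (\<forall>v\<in>tangent_space \<A> y. g y (I i y u) (I i y v) = g y u v))"

definition quaternion_kaehler ::
  "('m::{t2_space, second_countable_topology}, 'e::euclidean_space) atlas \<Rightarrow> 'm metric_tensor \<Rightarrow>
   'm connection \<Rightarrow> ('m \<Rightarrow> 'm tendo set) \<Rightarrow> bool" where
  "quaternion_kaehler \<A> g nab Q \<longleftrightarrow>
     smooth_atlas \<A> \<and> riemannian_metric \<A> g \<and> levi_civita \<A> g nab \<and>
     (\<forall>x. \<exists>W I. x \<in> W \<and> quaternionic_frame \<A> g Q W I) \<and>
     (\<forall>W J. open W \<longrightarrow> smooth_endo_on \<A> W J \<longrightarrow> (\<forall>y\<in>W. J y \<in> Q y) \<longrightarrow>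
        (\<forall>x\<in>W. \<forall>v\<in>tangent_space \<A> x. \<exists>K\<in>Q x. has_cov_deriv \<A> nab J x v K))"


section \<open>Lie groups and their actions\<close>

definition lie_group ::
  "('g::{t2_space, second_countable_topology}, 'l::euclidean_space) atlas \<Rightarrow> 'g monoid \<Rightarrow> bool" where
  "lie_group \<G> G \<longleftrightarrow> smooth_atlas \<G> \<and> group G \<and> carrier G = UNIV \<and>
     smooth_map (product_atlas \<G> \<G>) \<G> (\<lambda>(h, k). h \<otimes>\<^bsub>G\<^esub> k) \<and>
     smooth_map \<G> \<G> (\<lambda>h. inv\<^bsub>G\<^esub> h)"

definition left_invariant_vf ::
  "('g::topological_space, 'l::euclidean_space) atlas \<Rightarrow> 'g monoid \<Rightarrow> 'g tvec \<Rightarrow> 'g \<Rightarrow> 'g tvec" where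
  "left_invariant_vf \<G> G D h = differential \<G> (\<lambda>k. h \<otimes>\<^bsub>G\<^esub> k) \<one>\<^bsub>G\<^esub> D"

text \<open>
  The Lie algebra is a Euclidean space \<^typ>\<open>'l\<close> identified with the tangent space of \<open>G\<close> at the
  identity by a linear isomorphism \<open>\<iota>\<close>.
\<close>

definition lie_bracket ::
  "('g::topological_space, 'l::euclidean_space) atlas \<Rightarrow> 'g monoid \<Rightarrow> ('l \<Rightarrow> 'g tvec) \<Rightarrow>
   'l \<Rightarrow> 'l \<Rightarrow> 'l" where
  "lie_bracket \<G> G \<iota> A B = inv_into UNIV \<iota>
     (vf_bracket \<G> (left_invariant_vf \<G> G (\<iota> A)) (left_invariant_vf \<G> G (\<iota> B)) \<one>\<^bsub>G\<^esub>)"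

definition killing_form ::
  "('g::topological_space, 'l::euclidean_space) atlas \<Rightarrow> 'g monoid \<Rightarrow> ('l \<Rightarrow> 'g tvec) \<Rightarrow>
   'l \<Rightarrow> 'l \<Rightarrow> real" where
  "killing_form \<G> G \<iota> A B =
     (\<Sum>b\<in>Basis. lie_bracket \<G> G \<iota> A (lie_bracket \<G> G \<iota> B b) \<bullet> b)"

definition lie_algebra_identification ::
  "('g::topological_space, 'l::euclidean_space) atlas \<Rightarrow> 'g monoid \<Rightarrow> ('l \<Rightarrow> 'g tvec) \<Rightarrow> bool" where
  "lie_algebra_identification \<G> G \<iota> \<longleftrightarrow>
     linear \<iota> \<and> bij_betw \<iota> UNIV (tangent_space \<G> \<one>\<^bsub>G\<^esub>) \<and>
     (\<forall>A B. A \<bullet> B = - killing_form \<G> G \<iota> A B)"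

text \<open>The value at \<open>x\<close> is the velocity at time 0 of the curve \<open>exp (t A) x\<close>.\<close>

definition killing_field ::
  "('m::topological_space, 'e::euclidean_space) atlas \<Rightarrow> 'g monoid \<Rightarrow> ('l \<Rightarrow> 'g tvec) \<Rightarrow>
   ('g \<Rightarrow> 'm \<Rightarrow> 'm) \<Rightarrow> 'l \<Rightarrow> 'm \<Rightarrow> 'm tvec" where
  "killing_field \<A> G \<iota> act A x = differential \<A> (\<lambda>h. act h x) \<one>\<^bsub>G\<^esub> (\<iota> A)"

definition quaternionic_isometric_action ::
  "('g::topological_space, 'l::euclidean_space) atlas \<Rightarrow> 'g monoid \<Rightarrow>
   ('m::topological_space, 'e::euclidean_space) atlas \<Rightarrow> 'm metric_tensor \<Rightarrow> ('m \<Rightarrow> 'm tendo set) \<Rightarrow>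
   ('g \<Rightarrow> 'm \<Rightarrow> 'm) \<Rightarrow> bool" where
  "quaternionic_isometric_action \<G> G \<A> g Q act \<longleftrightarrow>
     group_action G UNIV act \<and>
     smooth_map (product_atlas \<G> \<A>) \<A> (\<lambda>(h, x). act h x) \<and>
     (\<forall>h x. \<forall>u\<in>tangent_space \<A> x. \<forall>v\<in>tangent_space \<A> x.
        g (act h x) (differential \<A> (act h) x u) (differential \<A> (act h) x v) = g x u v) \<and>
     (\<forall>h x. \<forall>J\<in>Q x. \<exists>J'\<in>Q (act h x). \<forall>u\<in>tangent_space \<A> x.
        differential \<A> (act h) x (J u) = J' (differential \<A> (act h) x u))"


section \<open>The moment map\<close>

text \<open>
  A section \<open>\<mu>\<close> of \<open>S\<^sup>2H \<otimes> \<g>\<close> is given by its contractions \<open>\<mu> A\<close>, which are sections of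
  \<open>S\<^sup>2H\<close> depending linearly on \<open>A\<close>.
\<close>

definition moment_map ::
  "('m::topological_space, 'e::euclidean_space) atlas \<Rightarrow> 'm metric_tensor \<Rightarrow> 'm connection \<Rightarrow>
   ('m \<Rightarrow> 'm tendo set) \<Rightarrow> 'g monoid \<Rightarrow> ('l::euclidean_space \<Rightarrow> 'g tvec) \<Rightarrow> ('g \<Rightarrow> 'm \<Rightarrow> 'm) \<Rightarrow>
   ('l \<Rightarrow> 'm \<Rightarrow> 'm tendo) \<Rightarrow> bool" where
  "moment_map \<A> g nab Q G \<iota> act \<mu> \<longleftrightarrow>
     (\<forall>x. linear (\<lambda>A. \<mu> A x)) \<and>
     (\<forall>A. smooth_endo_on \<A> UNIV (\<mu> A) \<and> (\<forall>x. \<mu> A x \<in> Q x)) \<and>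
     (\<forall>A W I. quaternionic_frame \<A> g Q W I \<longrightarrow> (\<forall>x\<in>W. \<forall>v\<in>tangent_space \<A> x.
        has_cov_deriv \<A> nab (\<mu> A) x v
          (\<Sum>i\<in>UNIV. g x (I i x (killing_field \<A> G \<iota> act A x)) v *\<^sub>R I i x)))"

text \<open>
  \<open>I\<close> is a quaternionic frame of \<open>S\<^sup>2H\<close> near \<open>x\<close>, and \<open>\<mu> = \<Sum>\<^sub>i I\<^sub>i \<otimes> B\<^sub>i\<close> at \<open>x\<close>.
\<close>

definition moment_components ::
  "('m::topological_space, 'e::euclidean_space) atlas \<Rightarrow> 'm metric_tensor \<Rightarrow> ('m \<Rightarrow> 'm tendo set) \<Rightarrow>
   ('l::euclidean_space \<Rightarrow> 'm \<Rightarrow> 'm tendo) \<Rightarrow> 'm \<Rightarrow> (3 \<Rightarrow> 'm \<Rightarrow> 'm tendo) \<Rightarrow> (3 \<Rightarrow> 'l) \<Rightarrow> bool" where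
  "moment_components \<A> g Q \<mu> x I B \<longleftrightarrow>
     (\<exists>W. x \<in> W \<and> quaternionic_frame \<A> g Q W I) \<and>
     (\<forall>A. \<mu> A x = (\<Sum>i\<in>UNIV. (B i \<bullet> A) *\<^sub>R I i x))"

definition regular_set ::
  "('m::topological_space, 'e::euclidean_space) atlas \<Rightarrow> 'm metric_tensor \<Rightarrow> ('m \<Rightarrow> 'm tendo set) \<Rightarrow>
   ('l::euclidean_space \<Rightarrow> 'm \<Rightarrow> 'm tendo) \<Rightarrow> 'm set" where
  "regular_set \<A> g Q \<mu> =
     {x. \<exists>I B. moment_components \<A> g Q \<mu> x I B \<and> inj B \<and> independent (range B)}"


section \<open>The Grassmannian of oriented 3-planes\<close>

text \<open>An oriented 3-plane is represented by the set of its positively oriented bases.\<close>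

type_synonym 'l oplane = "(3 \<Rightarrow> 'l) set"

definition oriented_span :: "(3 \<Rightarrow> 'l::euclidean_space) \<Rightarrow> 'l oplane" where
  "oriented_span b = {b'. \<exists>C :: real^3^3. det C > 0 \<and> (\<forall>i. b' i = (\<Sum>j\<in>UNIV. (C $ i $ j) *\<^sub>R b j))}"

definition grassmannian3 :: "'l::euclidean_space oplane set" where
  "grassmannian3 = {oriented_span b | b. inj b \<and> independent (range b)}"

definition plane :: "'l::euclidean_space oplane \<Rightarrow> 'l set" where
  "plane V = span (\<Union>b\<in>V. range b)"

text \<open>
  The tangent space of the Grassmannian at \<open>V\<close> is \<open>Hom(V, V\<^sup>\<bottom>)\<close>; its elements are extended by
  zero on \<open>V\<^sup>\<bottom>\<close>.
\<close>

definition grassmann_tangent :: "'l::euclidean_space oplane \<Rightarrow> ('l \<Rightarrow> 'l) set" where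
  "grassmann_tangent V = {L. linear L \<and>
     (\<forall>w \<in> plane V. L w \<in> (plane V)\<^sup>\<bottom>) \<and> (\<forall>w \<in> (plane V)\<^sup>\<bottom>. L w = 0)}"

text \<open>The isomorphism \<open>V \<otimes> V\<^sup>\<bottom> \<cong> Hom(V, V\<^sup>\<bottom>)\<close> on decomposable tensors.\<close>

definition tensor :: "'l::euclidean_space \<Rightarrow> 'l \<Rightarrow> 'l \<Rightarrow> 'l" where
  "tensor v p = (\<lambda>w. (v \<bullet> w) *\<^sub>R p)"

definition grassmann_metric :: "('l::euclidean_space \<Rightarrow> 'l) \<Rightarrow> ('l \<Rightarrow> 'l) \<Rightarrow> real" where
  "grassmann_metric L L' = (\<Sum>b\<in>Basis. L b \<bullet> L' b)"

text \<open>This is the tensor product metric:\<close>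

lemma grassmann_metric_tensor:
  "grassmann_metric (tensor v p) (tensor v' p') = (v \<bullet> v') * (p \<bullet> p')"
proof -
  have "grassmann_metric (tensor v p) (tensor v' p') = (\<Sum>b\<in>Basis. (v \<bullet> b) * (v' \<bullet> b)) * (p \<bullet> p')"
    by (simp add: grassmann_metric_def tensor_def sum_distrib_left sum_distrib_right mult_ac)
  then show ?thesis
    by (simp add: euclidean_inner[of v v'])
qed

lemma tensor_in_grassmann_tangent:
  assumes "v \<in> plane V" "p \<in> (plane V)\<^sup>\<bottom>"
  shows "tensor v p \<in> grassmann_tangent V"
proof -
  have "linear (tensor v p)"
    unfolding tensor_def by (intro linearI) (auto simp: inner_add_right scaleR_add_left)
  moreover have "tensor v p w \<in> (plane V)\<^sup>\<bottom>" for w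
    unfolding tensor_def using assms(2) by (simp add: subspace_orthogonal_comp subspace_mul)
  moreover have "tensor v p w = 0" if "w \<in> (plane V)\<^sup>\<bottom>" for w
    using assms(1) that by (auto simp: tensor_def orthogonal_comp_def orthogonal_def)
  ultimately show ?thesis
    by (auto simp: grassmann_tangent_def)
qed

text \<open>
  The standard chart of the Grassmannian centred at \<open>V\<close>, with values in \<open>Hom(V, V\<^sup>\<bottom>)\<close>: it sends
  the oriented graph of \<open>L\<close>, that is the image of \<open>V\<close> under \<open>id + L\<close>, to \<open>L\<close>. Its derivative at the
  centre is the identification of the tangent space with \<open>Hom(V, V\<^sup>\<bottom>)\<close>.
\<close>

definition oriented_graph :: "'l::euclidean_space oplane \<Rightarrow> ('l \<Rightarrow> 'l) \<Rightarrow> 'l oplane" where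
  "oriented_graph V L = (\<lambda>b i. b i + L (b i)) ` V"

definition graph_chart :: "'l::euclidean_space oplane \<Rightarrow> 'l oplane \<Rightarrow> 'l \<Rightarrow> 'l" where
  "graph_chart V W = (THE L. L \<in> grassmann_tangent V \<and> oriented_graph V L = W)"

text \<open>The differential at \<open>x\<close> of a map into the Grassmannian, in the chart centred at the image of \<open>x\<close>.\<close>

definition grassmann_differential ::
  "('m \<Rightarrow> 'l::euclidean_space oplane) \<Rightarrow> 'm \<Rightarrow> 'm tvec \<Rightarrow> 'l \<Rightarrow> 'l" where
  "grassmann_differential F x X = (\<lambda>w. deriv_along X (\<lambda>y. graph_chart (F x) (F y) w))"


section \<open>The map induced by the moment map\<close>

definition Psi ::
  "('m::topological_space, 'e::euclidean_space) atlas \<Rightarrow> 'm metric_tensor \<Rightarrow> ('m \<Rightarrow> 'm tendo set) \<Rightarrow>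
   ('l::euclidean_space \<Rightarrow> 'm \<Rightarrow> 'm tendo) \<Rightarrow> 'm \<Rightarrow> 'l oplane" where
  "Psi \<A> g Q \<mu> x = (THE P. \<exists>I B. moment_components \<A> g Q \<mu> x I B \<and> P = oriented_span B)"

definition natural_endo ::
  "('m::topological_space, 'e::euclidean_space) atlas \<Rightarrow> 'm metric_tensor \<Rightarrow>
   ('m \<Rightarrow> 'l::euclidean_space oplane) \<Rightarrow> 'm \<Rightarrow> 'm tvec \<Rightarrow> 'm tvec" where
  "natural_endo \<A> g \<Psi> x X = sharp \<A> g x
     (\<lambda>Z. grassmann_metric (grassmann_differential \<Psi> x X) (grassmann_differential \<Psi> x Z))"

definition oriented_orthonormal_basis :: "'l::euclidean_space oplane \<Rightarrow> (3 \<Rightarrow> 'l) \<Rightarrow> bool" where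
  "oriented_orthonormal_basis V v \<longleftrightarrow> v \<in> V \<and> (\<forall>i j. v i \<bullet> v j = (if i = j then 1 else 0))"

end

theory Submission
  imports Defs
begin

text \<open>
  Write \<open>V = \<Psi>(x)\<close> and let \<open>Z\<close> be a tangent vector at \<open>x\<close>. Near \<open>x\<close> the moment map is
  \<open>\<mu> = \<Sum>\<^sub>i I\<^sub>i \<otimes> B\<^sub>i\<close> with functions \<open>B\<^sub>i\<close> that take values in the Lie algebra, and
  \<open>B\<^sub>i(x) = \<lambda> v\<^sub>i\<close>. Differentiate the contraction \<open>\<mu>\<^sub>p = \<Sum>\<^sub>i (B\<^sub>i \<bullet> p) I\<^sub>i\<close> with a vector \<open>p\<close> orthogonal
  to \<open>V\<close>. Its coefficients vanish at \<open>x\<close>, so the derivatives of the \<open>I\<^sub>i\<close> drop out of the Leibniz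
  rule, and comparing coefficients with the equation of the moment map gives
  \<open>Z (B\<^sub>i \<bullet> p) = g (I\<^sub>i K\<^sub>p, Z)\<close>, where \<open>K\<^sub>p\<close> is the Killing field of \<open>p\<close>. This is
  \<open>moment_coordinates\<close>.

  The plane \<open>\<Psi>(y)\<close> is spanned by the \<open>B\<^sub>i(y)\<close> (\<open>Psi_eq\<close>). To read it in the graph chart centred at
  \<open>V\<close>, replace the \<open>B\<^sub>i(y)\<close> by the basis \<open>c\<^sub>i(y)\<close> of \<open>\<Psi>(y)\<close> that projects to \<open>v\<^sub>i\<close>; the chart sends
  \<open>\<Psi>(y)\<close> to the map \<open>v\<^sub>i \<mapsto> c\<^sub>i(y) - v\<^sub>i\<close> (\<open>graph_chart_eq\<close>). The matrix that carries \<open>B(y)\<close> to \<open>c(y)\<close>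
  is \<open>1/\<lambda>\<close> times the identity at \<open>x\<close>, and its derivative is multiplied by \<open>B\<^sub>i(x) \<bullet> p = 0\<close>. Hence
  \<open>\<Psi>\<^sub>* Z = \<Sum>\<^sub>i v\<^sub>i \<otimes> q\<^sub>i\<close> with \<open>p \<bullet> q\<^sub>i = (1/\<lambda>) g (I\<^sub>i K\<^sub>p, Z)\<close> (\<open>Psi_differential\<close>).

  Consequently \<open>\<langle>\<Psi>\<^sub>* Y, \<Psi>\<^sub>* Z\<rangle> = \<Sum>\<^sub>i p\<^sub>i \<bullet> q\<^sub>i = g ((1/\<lambda>) \<Sum>\<^sub>i I\<^sub>i K\<^bsub>p\<^sub>i\<^esub>, Z)\<close> for every \<open>Z\<close>, and since \<open>g\<close> is
  nondegenerate this determines the vector that represents the left side.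

  The analysis behind these lines is the smoothness of the \<open>B\<^sub>i\<close>: a derivation acts as a derivative
  only on smooth germs and is zero on all others. Evaluating \<open>\<mu>\<close> and the frame on a smooth
  nonvanishing vector field expresses \<open>B\<^sub>i \<bullet> a\<close> as a quotient of values of the metric.
\<close>

section \<open>Calculus of \<open>C\<^sup>k\<close> maps\<close>

lemma Ck_on_const: "Ck_on k S (\<lambda>_. c)"
proof (induction k arbitrary: c)
  case (Suc k)
  have "\<forall>x\<in>S. ((\<lambda>_. c) has_derivative (\<lambda>_. 0)) (at x)" by simp
  then show ?case unfolding Ck_on.simps by (intro exI[of _ "\<lambda>_ _. 0"]) (simp add: Suc)
qed simp

lemma Ck_on_Suc_imp: "Ck_on (Suc k) S f \<Longrightarrow> Ck_on k S f"
proof (induction k arbitrary: f)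
  case 0
  then show ?case
    by (auto intro!: continuous_at_imp_continuous_on dest!: has_derivative_continuous)
next
  case (Suc k)
  from Suc.prems obtain f' where
    "\<forall>x\<in>S. (f has_derivative f' x) (at x)" and "\<forall>v. Ck_on (Suc k) S (\<lambda>x. f' x v)"
    unfolding Ck_on.simps(2)[of "Suc k"] by blast
  with Suc.IH have "\<forall>v. Ck_on k S (\<lambda>x. f' x v)" by blast
  with \<open>\<forall>x\<in>S. (f has_derivative f' x) (at x)\<close> show ?case unfolding Ck_on.simps by blast
qed

lemma Ck_on_subset: "Ck_on k S f \<Longrightarrow> T \<subseteq> S \<Longrightarrow> Ck_on k T f"
proof (induction k arbitrary: f)
  case (Suc k)
  then show ?case unfolding Ck_on.simps by (meson subset_iff)
qed (auto intro: continuous_on_subset)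

text \<open>
  Openness of \<open>S\<close> is essential: the derivatives in the definition are two-sided, so they see values
  on a full neighbourhood of each point.
\<close>

lemma Ck_on_cong:
  assumes "open S" "\<And>x. x \<in> S \<Longrightarrow> f x = h x" "Ck_on k S f"
  shows "Ck_on k S h"
proof (cases k)
  case 0
  then show ?thesis using assms by (auto cong: continuous_on_cong)
next
  case (Suc n)
  with assms obtain f' where f': "\<forall>x\<in>S. (f has_derivative f' x) (at x)" "\<forall>v. Ck_on n S (\<lambda>x. f' x v)"
    by auto
  have "(h has_derivative f' x) (at x)" if "x \<in> S" for x
    using f'(1) that assms(1,2) has_derivative_transform_within_open by blast
  then show ?thesis using f'(2) Suc by auto
qed

lemma Ck_on_add: "Ck_on k S f \<Longrightarrow> Ck_on k S h \<Longrightarrow> Ck_on k S (\<lambda>x. f x + h x)"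
proof (induction k arbitrary: f h)
  case 0
  then show ?case by (auto intro: continuous_on_add)
next
  case (Suc k)
  from Suc.prems obtain f' h' where
    "\<forall>x\<in>S. (f has_derivative f' x) (at x)" "\<forall>v. Ck_on k S (\<lambda>x. f' x v)"
    "\<forall>x\<in>S. (h has_derivative h' x) (at x)" "\<forall>v. Ck_on k S (\<lambda>x. h' x v)" by auto
  then have "\<forall>x\<in>S. ((\<lambda>x. f x + h x) has_derivative (\<lambda>v. f' x v + h' x v)) (at x)"
    "\<forall>v. Ck_on k S (\<lambda>x. f' x v + h' x v)"
    by (auto intro: has_derivative_add Suc.IH)
  then show ?case unfolding Ck_on.simps by (intro exI[of _ "\<lambda>x v. f' x v + h' x v"]) simp
qed

lemma Ck_on_mult:
  fixes f h :: "'a::euclidean_space \<Rightarrow> real"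
  shows "Ck_on k S f \<Longrightarrow> Ck_on k S h \<Longrightarrow> Ck_on k S (\<lambda>x. f x * h x)"
proof (induction k arbitrary: f h)
  case 0
  then show ?case by (auto intro: continuous_on_mult)
next
  case (Suc k)
  from Suc.prems obtain f' h' where
    "\<forall>x\<in>S. (f has_derivative f' x) (at x)" "\<forall>v. Ck_on k S (\<lambda>x. f' x v)"
    "\<forall>x\<in>S. (h has_derivative h' x) (at x)" "\<forall>v. Ck_on k S (\<lambda>x. h' x v)" by auto
  then have "\<forall>x\<in>S. ((\<lambda>x. f x * h x) has_derivative (\<lambda>v. f x * h' x v + f' x v * h x)) (at x)"
    "\<forall>v. Ck_on k S (\<lambda>x. f x * h' x v + f' x v * h x)"
    by (auto intro!: has_derivative_mult Suc.IH Ck_on_add Suc.prems[THEN Ck_on_Suc_imp])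
  then show ?case unfolding Ck_on.simps by (intro exI[of _ "\<lambda>x v. f x * h' x v + f' x v * h x"]) simp
qed

lemma Ck_on_inverse:
  fixes f :: "'a::euclidean_space \<Rightarrow> real"
  shows "Ck_on k S f \<Longrightarrow> (\<And>x. x \<in> S \<Longrightarrow> f x \<noteq> 0) \<Longrightarrow> Ck_on k S (\<lambda>x. inverse (f x))"
proof (induction k arbitrary: f)
  case 0
  then show ?case by (auto intro: continuous_on_inverse)
next
  case (Suc k)
  let ?d = "\<lambda>f' x v. (-1) * (inverse (f x) * (f' x v * inverse (f x)))"
  from Suc.prems obtain f' where f':
    "\<forall>x\<in>S. (f has_derivative f' x) (at x)" "\<forall>v. Ck_on k S (\<lambda>x. f' x v)" by auto
  have "\<forall>x\<in>S. ((\<lambda>x. inverse (f x)) has_derivative ?d f' x) (at x)"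
  proof
    fix x assume "x \<in> S"
    then have "((\<lambda>x. inverse (f x)) has_derivative (\<lambda>v. - (inverse (f x) * f' x v * inverse (f x)))) (at x)"
      using f'(1) Suc.prems(2) by (intro Deriv.has_derivative_inverse) auto
    then show "((\<lambda>x. inverse (f x)) has_derivative ?d f' x) (at x)" by (simp add: mult.assoc)
  qed
  moreover have "\<forall>v. Ck_on k S (\<lambda>x. ?d f' x v)"
    using f'(2) Suc.prems Suc.IH[OF Ck_on_Suc_imp] by (intro allI Ck_on_mult Ck_on_const) auto
  ultimately show ?case unfolding Ck_on.simps by (intro exI[of _ "?d f'"]) blast
qed

lemma Ck_on_inner: "Ck_on k S f \<Longrightarrow> Ck_on k S (\<lambda>x. f x \<bullet> b)"
proof (induction k arbitrary: f)
  case 0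
  then show ?case by (auto intro: continuous_on_inner)
next
  case (Suc k)
  from Suc.prems obtain f' where f':
    "\<forall>x\<in>S. (f has_derivative f' x) (at x)" "\<forall>v. Ck_on k S (\<lambda>x. f' x v)" by auto
  then have "\<forall>x\<in>S. ((\<lambda>x. f x \<bullet> b) has_derivative (\<lambda>v. f' x v \<bullet> b)) (at x)"
    by (auto intro: has_derivative_inner_left)
  with f'(2) Suc.IH show ?case unfolding Ck_on.simps
    by (intro exI[of _ "\<lambda>x v. f' x v \<bullet> b"]) auto
qed

lemma Ck_on_sum: "(\<And>i. i \<in> F \<Longrightarrow> Ck_on k S (f i)) \<Longrightarrow> Ck_on k S (\<lambda>x. \<Sum>i\<in>F. f i x)"
  by (induction F rule: infinite_finite_induct) (auto intro: Ck_on_const Ck_on_add)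

text \<open>
  By the chain rule the derivative of \<open>h \<circ> f\<close> along \<open>v\<close> is \<open>h'(f x)(f' x v)\<close>. Only derivatives along a
  fixed vector are known to be of class \<open>C\<^sup>k\<close>, so \<open>f' x v\<close> is expanded in the standard basis; each
  summand is then a product of two functions covered by the induction hypothesis.
\<close>

lemma Ck_on_compose:
  fixes h :: "'b::euclidean_space \<Rightarrow> real"
  shows "Ck_on k T h \<Longrightarrow> Ck_on k S f \<Longrightarrow> f ` S \<subseteq> T \<Longrightarrow> Ck_on k S (\<lambda>x. h (f x))"
proof (induction k arbitrary: h)
  case 0
  then show ?case by (auto intro: continuous_on_compose2)
next
  case (Suc k)
  from Suc.prems obtain f' h' where
    f': "\<forall>x\<in>S. (f has_derivative f' x) (at x)" "\<forall>v. Ck_on k S (\<lambda>x. f' x v)" and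
    h': "\<forall>x\<in>T. (h has_derivative h' x) (at x)" "\<forall>v. Ck_on k T (\<lambda>x. h' x v)" by auto
  let ?d = "\<lambda>x v. \<Sum>b\<in>Basis. (f' x v \<bullet> b) * h' (f x) b"
  have lin: "h' y v = (\<Sum>b\<in>Basis. (v \<bullet> b) * h' y b)" if "y \<in> T" for y v
  proof -
    have "linear (h' y)" using h'(1) that has_derivative_linear by blast
    then have "h' y (\<Sum>b\<in>Basis. (v \<bullet> b) *\<^sub>R b) = (\<Sum>b\<in>Basis. (v \<bullet> b) * h' y b)"
      by (simp add: linear_sum linear_cmul)
    then show ?thesis by (simp add: euclidean_representation)
  qed
  have "((\<lambda>x. h (f x)) has_derivative ?d x) (at x)" if "x \<in> S" for x
  proof -
    have "f x \<in> T" using that Suc.prems(3) by blast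
    then have "((\<lambda>x. h (f x)) has_derivative (\<lambda>v. h' (f x) (f' x v))) (at x)"
      using has_derivative_compose f'(1) h'(1) that by blast
    moreover have "(\<lambda>v. h' (f x) (f' x v)) = ?d x"
      using lin[OF \<open>f x \<in> T\<close>] by (intro ext)
    ultimately show ?thesis by metis
  qed
  moreover have "Ck_on k S (\<lambda>x. ?d x v)" for v
  proof (intro Ck_on_sum Ck_on_mult)
    show "Ck_on k S (\<lambda>x. f' x v \<bullet> b)" for b using f'(2) by (intro Ck_on_inner) blast
    show "Ck_on k S (\<lambda>x. h' (f x) b)" for b
      by (rule Suc.IH[OF _ Ck_on_Suc_imp[OF Suc.prems(2)] Suc.prems(3)]) (use h'(2) in blast)
  qed
  ultimately show ?case unfolding Ck_on.simps by (intro exI[of _ ?d]) blast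
qed

section \<open>Functions, derivations and vector fields on a manifold\<close>

locale smooth_manifold =
  fixes \<A> :: "('m::{t2_space, second_countable_topology}, 'e::euclidean_space) atlas"
  assumes smooth_atlas: "smooth_atlas \<A>"
begin

lemma chart_at: obtains U \<phi> where "(U, \<phi>) \<in> \<A>" "x \<in> U"
proof -
  have "x \<in> (\<Union>(U, \<phi>)\<in>\<A>. U)" using smooth_atlas by (simp add: smooth_atlas_def)
  then show ?thesis using that by auto
qed

lemma
  assumes "(U, \<phi>) \<in> \<A>"
  shows open_chart_domain: "open U"
    and homeomorphism_chart: "homeomorphism U (\<phi> ` U) \<phi> (inv_into U \<phi>)"
    and open_chart_range: "open (\<phi> ` U)"
  using smooth_atlas assms unfolding smooth_atlas_def by auto

lemma inv_into_chart: "(U, \<phi>) \<in> \<A> \<Longrightarrow> y \<in> U \<Longrightarrow> inv_into U \<phi> (\<phi> y) = y"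
  by (rule homeomorphism_apply1[OF homeomorphism_chart])

lemma open_chart_image:
  assumes "(U, \<phi>) \<in> \<A>" "open W"
  shows "open (\<phi> ` (U \<inter> W))"
proof -
  have "openin (top_of_set (\<phi> ` U)) (\<phi> ` (U \<inter> W))"
    using homeomorphism_imp_open_map[OF homeomorphism_chart[OF assms(1)]] assms(2)
    by (simp add: openin_open_Int)
  then show ?thesis using open_chart_range[OF assms(1)] openin_open_eq by blast
qed

lemma transition_smooth:
  "(U, \<phi>) \<in> \<A> \<Longrightarrow> (V, \<psi>) \<in> \<A> \<Longrightarrow> smooth_on (\<phi> ` (U \<inter> V)) (\<lambda>z. \<psi> (inv_into U \<phi> z))"
  using smooth_atlas unfolding smooth_atlas_def comp_def by fast

lemma smooth_fun_on_const: "smooth_fun_on \<A> W (\<lambda>_. c)"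
  by (auto simp: smooth_fun_on_def smooth_on_def comp_def Ck_on_const)

lemma smooth_fun_on_subset: "smooth_fun_on \<A> W f \<Longrightarrow> W' \<subseteq> W \<Longrightarrow> smooth_fun_on \<A> W' f"
  unfolding smooth_fun_on_def smooth_on_def by (blast intro: Ck_on_subset)

lemma smooth_fun_on_cong:
  assumes "open W" "\<And>y. y \<in> W \<Longrightarrow> f y = h y" "smooth_fun_on \<A> W f"
  shows "smooth_fun_on \<A> W h"
  unfolding smooth_fun_on_def smooth_on_def
proof (clarify)
  fix U \<phi> k assume c: "(U, \<phi>) \<in> \<A>"
  show "Ck_on k (\<phi> ` (U \<inter> W)) (h \<circ> inv_into U \<phi>)"
  proof (rule Ck_on_cong[OF open_chart_image[OF c assms(1)]])
    show "Ck_on k (\<phi> ` (U \<inter> W)) (f \<circ> inv_into U \<phi>)"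
      using assms(3) c unfolding smooth_fun_on_def smooth_on_def by blast
    show "(f \<circ> inv_into U \<phi>) z = (h \<circ> inv_into U \<phi>) z" if "z \<in> \<phi> ` (U \<inter> W)" for z
      using that assms(2) inv_into_chart[OF c] by auto
  qed
qed

lemma smooth_fun_on_add:
  "smooth_fun_on \<A> W f \<Longrightarrow> smooth_fun_on \<A> W h \<Longrightarrow> smooth_fun_on \<A> W (\<lambda>y. f y + h y)"
  unfolding smooth_fun_on_def smooth_on_def comp_def by (auto intro!: Ck_on_add)

lemma smooth_fun_on_mult:
  fixes f h :: "'m \<Rightarrow> real"
  shows "smooth_fun_on \<A> W f \<Longrightarrow> smooth_fun_on \<A> W h \<Longrightarrow> smooth_fun_on \<A> W (\<lambda>y. f y * h y)"
  unfolding smooth_fun_on_def smooth_on_def comp_def by (auto intro!: Ck_on_mult)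

lemma smooth_fun_on_inverse:
  fixes f :: "'m \<Rightarrow> real"
  assumes "smooth_fun_on \<A> W f" "\<And>y. y \<in> W \<Longrightarrow> f y \<noteq> 0"
  shows "smooth_fun_on \<A> W (\<lambda>y. inverse (f y))"
  unfolding smooth_fun_on_def smooth_on_def comp_def
proof clarify
  fix U \<phi> k assume c: "(U, \<phi>) \<in> \<A>"
  show "Ck_on k (\<phi> ` (U \<inter> W)) (\<lambda>z. inverse (f (inv_into U \<phi> z)))"
    using assms c inv_into_chart[OF c] unfolding smooth_fun_on_def smooth_on_def comp_def
    by (intro Ck_on_inverse) auto
qed

lemma smooth_nearI: "open W \<Longrightarrow> x \<in> W \<Longrightarrow> smooth_fun_on \<A> W f \<Longrightarrow> smooth_near \<A> x f"
  unfolding smooth_near_def by blast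

lemma smooth_near_const: "smooth_near \<A> x (\<lambda>_. c)"
  by (rule smooth_nearI[of UNIV]) (auto intro: smooth_fun_on_const)

lemma smooth_near_binop:
  assumes "smooth_near \<A> x f" "smooth_near \<A> x h"
    "\<And>W. smooth_fun_on \<A> W f \<Longrightarrow> smooth_fun_on \<A> W h \<Longrightarrow> smooth_fun_on \<A> W k"
  shows "smooth_near \<A> x k"
proof -
  obtain W1 W2 where "open W1" "x \<in> W1" "smooth_fun_on \<A> W1 f" "open W2" "x \<in> W2" "smooth_fun_on \<A> W2 h"
    using assms(1,2) unfolding smooth_near_def by blast
  moreover from this have "smooth_fun_on \<A> (W1 \<inter> W2) k"
    by (intro assms(3)) (auto elim: smooth_fun_on_subset)
  ultimately show ?thesis by (intro smooth_nearI[of "W1 \<inter> W2"]) auto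
qed

lemma smooth_near_add:
  "smooth_near \<A> x f \<Longrightarrow> smooth_near \<A> x h \<Longrightarrow> smooth_near \<A> x (\<lambda>y. f y + h y)"
  by (erule (1) smooth_near_binop) (rule smooth_fun_on_add)

lemma smooth_near_mult:
  fixes f h :: "'m \<Rightarrow> real"
  shows "smooth_near \<A> x f \<Longrightarrow> smooth_near \<A> x h \<Longrightarrow> smooth_near \<A> x (\<lambda>y. f y * h y)"
  by (erule (1) smooth_near_binop) (rule smooth_fun_on_mult)

lemma smooth_near_diff:
  fixes f h :: "'m \<Rightarrow> real"
  assumes "smooth_near \<A> x f" "smooth_near \<A> x h"
  shows "smooth_near \<A> x (\<lambda>y. f y - h y)"
  using smooth_near_add[OF assms(1) smooth_near_mult[OF smooth_near_const[of x "-1"] assms(2)]] by simp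

lemma smooth_near_sum:
  "(\<And>i. i \<in> F \<Longrightarrow> smooth_near \<A> x (f i)) \<Longrightarrow> smooth_near \<A> x (\<lambda>y. \<Sum>i\<in>F. f i y)"
  by (induction F rule: infinite_finite_induct) (auto intro: smooth_near_const smooth_near_add)

lemma smooth_near_cong:
  assumes "smooth_near \<A> x f" "eventually (\<lambda>y. f y = h y) (nhds x)"
  shows "smooth_near \<A> x h"
proof -
  obtain W1 W2 where "open W1" "x \<in> W1" "smooth_fun_on \<A> W1 f" "open W2" "x \<in> W2" "\<forall>y\<in>W2. f y = h y"
    using assms unfolding smooth_near_def eventually_nhds by blast
  then show ?thesis
    by (intro smooth_nearI[of "W1 \<inter> W2"] smooth_fun_on_cong[of _ f h])
       (auto intro: smooth_fun_on_subset)
qed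

lemma smooth_near_isCont:
  fixes f :: "'m \<Rightarrow> 'b::euclidean_space"
  assumes "smooth_near \<A> x f"
  shows "isCont f x"
proof -
  obtain W where W: "open W" "x \<in> W" "smooth_fun_on \<A> W f"
    using assms unfolding smooth_near_def by blast
  obtain U \<phi> where c: "(U, \<phi>) \<in> \<A>" "x \<in> U" by (rule chart_at)
  have "Ck_on 0 (\<phi> ` (U \<inter> W)) (f \<circ> inv_into U \<phi>)"
    using W(3) c(1) unfolding smooth_fun_on_def smooth_on_def by blast
  moreover have "continuous_on (U \<inter> W) \<phi>"
    using homeomorphism_cont1[OF homeomorphism_chart[OF c(1)]] continuous_on_subset by blast
  ultimately have "continuous_on (U \<inter> W) (\<lambda>y. (f \<circ> inv_into U \<phi>) (\<phi> y))"
    by (auto intro: continuous_on_compose2)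
  then have "continuous_on (U \<inter> W) f"
    by (rule continuous_on_eq) (simp add: inv_into_chart[OF c(1)])
  then show ?thesis
    using continuous_on_eq_continuous_at[of "U \<inter> W" f] open_chart_domain[OF c(1)] W(1,2) c(2)
    by auto
qed

lemma smooth_near_inverse:
  fixes f :: "'m \<Rightarrow> real"
  assumes "smooth_near \<A> x f" "f x \<noteq> 0"
  shows "smooth_near \<A> x (\<lambda>y. inverse (f y))"
proof -
  have "eventually (\<lambda>y. f y \<noteq> 0) (nhds x)"
  proof -
    have "eventually (\<lambda>y. f y \<noteq> 0) (at x)"
      using smooth_near_isCont[OF assms(1)] assms(2) unfolding isCont_def by (rule tendsto_imp_eventually_ne)
    then show ?thesis unfolding eventually_at_filter by (rule eventually_mono) (use assms(2) in auto)
  qed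
  then obtain W2 where "open W2" "x \<in> W2" "\<forall>y\<in>W2. f y \<noteq> 0" unfolding eventually_nhds by blast
  moreover obtain W where "open W" "x \<in> W" "smooth_fun_on \<A> W f"
    using assms unfolding smooth_near_def by blast
  ultimately show ?thesis
    by (intro smooth_nearI[of "W \<inter> W2"] smooth_fun_on_inverse) (auto intro: smooth_fun_on_subset)
qed

lemma smooth_near_divide:
  fixes f h :: "'m \<Rightarrow> real"
  shows "smooth_near \<A> x f \<Longrightarrow> smooth_near \<A> x h \<Longrightarrow> h x \<noteq> 0 \<Longrightarrow> smooth_near \<A> x (\<lambda>y. f y / h y)"
  unfolding divide_inverse by (intro smooth_near_mult smooth_near_inverse)

text \<open>
  The functions with which a local operator is shown to ignore values outside \<open>W\<close>: anything that
  vanishes on \<open>W\<close> is its own product with this one.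
\<close>

lemma smooth_near_indicator:
  assumes "open W" "x \<in> W"
  shows "smooth_near \<A> x (\<lambda>y. if y \<in> W then 0 else 1 :: real)"
  by (rule smooth_near_cong[OF smooth_near_const[of x 0]]) (use assms in \<open>auto simp: eventually_nhds\<close>)

lemma tangent_add: "D \<in> tangent_space \<A> x \<Longrightarrow> E \<in> tangent_space \<A> x \<Longrightarrow> D + E \<in> tangent_space \<A> x"
  unfolding tangent_space_def by (simp add: algebra_simps)

lemma tangent_scale: "D \<in> tangent_space \<A> x \<Longrightarrow> c *\<^sub>R D \<in> tangent_space \<A> x"
  unfolding tangent_space_def by (simp add: algebra_simps)

lemma tangent_0: "0 \<in> tangent_space \<A> x"
  unfolding tangent_space_def by simp

lemma tangent_diff: "D \<in> tangent_space \<A> x \<Longrightarrow> E \<in> tangent_space \<A> x \<Longrightarrow> D - E \<in> tangent_space \<A> x"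
  using tangent_add[of D x "(-1) *\<^sub>R E"] tangent_scale[of E x "-1"] by simp

lemma tangent_sum: "(\<And>i. i \<in> F \<Longrightarrow> D i \<in> tangent_space \<A> x) \<Longrightarrow> (\<Sum>i\<in>F. D i) \<in> tangent_space \<A> x"
  by (induction F rule: infinite_finite_induct) (auto intro: tangent_0 tangent_add)

context
  fixes x D assumes D: "D \<in> tangent_space \<A> x"
begin

lemma derivation_add: "smooth_near \<A> x f \<Longrightarrow> smooth_near \<A> x h \<Longrightarrow> D (\<lambda>y. f y + h y) = D f + D h"
  and derivation_cmult: "smooth_near \<A> x f \<Longrightarrow> D (\<lambda>y. c * f y) = c * D f"
  and derivation_mult: "smooth_near \<A> x f \<Longrightarrow> smooth_near \<A> x h \<Longrightarrow> D (\<lambda>y. f y * h y) = f x * D h + h x * D f"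
  using D unfolding tangent_space_def by blast+

lemma derivation_const: "D (\<lambda>_. c) = 0"
proof -
  have "D (\<lambda>_. 1) = 0" using derivation_mult[OF smooth_near_const[of x 1] smooth_near_const[of x 1]] by simp
  then show ?thesis using derivation_cmult[OF smooth_near_const[of x 1], of c] by simp
qed

lemma derivation_diff:
  assumes "smooth_near \<A> x f" "smooth_near \<A> x h"
  shows "D (\<lambda>y. f y - h y) = D f - D h"
proof -
  have "smooth_near \<A> x (\<lambda>y. - 1 * h y)" by (rule smooth_near_mult[OF smooth_near_const assms(2)])
  from derivation_add[OF assms(1) this] derivation_cmult[OF assms(2), of "-1"] show ?thesis by simp
qed

lemma derivation_sum:
  "(\<And>i. i \<in> F \<Longrightarrow> smooth_near \<A> x (f i)) \<Longrightarrow> D (\<lambda>y. \<Sum>i\<in>F. f i y) = (\<Sum>i\<in>F. D (f i))"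
  by (induction F rule: infinite_finite_induct)
     (auto simp: derivation_const derivation_add smooth_near_sum)

text \<open>
  With \<open>i\<close> the indicator of the complement of a neighbourhood on which \<open>f = h\<close>, the difference
  \<open>f - h = i (f - h)\<close> is a product of two functions vanishing at \<open>x\<close>, and the Leibniz rule kills it.
\<close>

lemma derivation_cong:
  assumes ev: "eventually (\<lambda>y. f y = h y) (nhds x)"
  shows "D f = D h"
proof (cases "smooth_near \<A> x f")
  case f: True
  note h = smooth_near_cong[OF f ev]
  obtain W where W: "open W" "x \<in> W" "\<And>y. y \<in> W \<Longrightarrow> f y = h y" using ev unfolding eventually_nhds by blast
  define i where "i = (\<lambda>y. if y \<in> W then 0 else 1 :: real)"
  have i: "smooth_near \<A> x i" unfolding i_def by (rule smooth_near_indicator[OF W(1,2)])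
  have "D (\<lambda>y. i y * (f y - h y)) = 0"
    using derivation_mult[OF i smooth_near_diff[OF f h]] W(2) W(3)[OF W(2)] by (simp add: i_def)
  moreover have "(\<lambda>y. i y * (f y - h y)) = (\<lambda>y. f y - h y)"
    using W(3) by (auto simp: i_def)
  ultimately show ?thesis using derivation_diff[OF f h] by simp
next
  case False
  moreover have "\<not> smooth_near \<A> x h"
    using False smooth_near_cong[of x h f] ev by (auto simp: eq_commute)
  ultimately show ?thesis using D unfolding tangent_space_def by auto
qed

lemma deriv_along_inner:
  assumes "\<And>b. b \<in> Basis \<Longrightarrow> smooth_near \<A> x (\<lambda>y. F y \<bullet> b)"
  shows "deriv_along D F \<bullet> q = D (\<lambda>y. F y \<bullet> q)"
proof -
  have "D (\<lambda>y. F y \<bullet> q) = D (\<lambda>y. \<Sum>b\<in>Basis. (q \<bullet> b) * (F y \<bullet> b))"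
    by (simp add: euclidean_inner[of _ q] mult.commute)
  also have "\<dots> = (\<Sum>b\<in>Basis. (q \<bullet> b) * D (\<lambda>y. F y \<bullet> b))"
    using assms by (simp add: derivation_sum derivation_cmult smooth_near_mult smooth_near_const)
  also have "\<dots> = deriv_along D F \<bullet> q"
    unfolding deriv_along_def by (simp add: inner_sum_left inner_commute[of q] mult.commute)
  finally show ?thesis ..
qed

end

lemma smooth_vf_on_tangent: "smooth_vf_on \<A> W X \<Longrightarrow> y \<in> W \<Longrightarrow> X y \<in> tangent_space \<A> y"
  unfolding smooth_vf_on_def by blast

lemma smooth_vf_on_subset: "smooth_vf_on \<A> W X \<Longrightarrow> W' \<subseteq> W \<Longrightarrow> smooth_vf_on \<A> W' X"
  unfolding smooth_vf_on_def by (meson subset_iff)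

lemma smooth_vf_on_add:
  "smooth_vf_on \<A> W X \<Longrightarrow> smooth_vf_on \<A> W Y \<Longrightarrow> smooth_vf_on \<A> W (\<lambda>y. X y + Y y)"
  unfolding smooth_vf_on_def by (auto intro: tangent_add smooth_fun_on_add)

lemma smooth_vf_on_scale:
  "smooth_fun_on \<A> W f \<Longrightarrow> smooth_vf_on \<A> W X \<Longrightarrow> smooth_vf_on \<A> W (\<lambda>y. f y *\<^sub>R X y)"
  unfolding smooth_vf_on_def
  by (auto intro: tangent_scale smooth_fun_on_mult smooth_fun_on_subset)

lemma smooth_vf_on_zero: "smooth_vf_on \<A> W (\<lambda>_. 0)"
  unfolding smooth_vf_on_def by (auto intro: tangent_0 smooth_fun_on_const)

lemma smooth_vf_on_cong:
  assumes "\<And>y. y \<in> W \<Longrightarrow> X y = Y y" "smooth_vf_on \<A> W X"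
  shows "smooth_vf_on \<A> W Y"
  unfolding smooth_vf_on_def
proof (intro conjI ballI allI impI)
  show "Y y \<in> tangent_space \<A> y" if "y \<in> W" for y
    using assms that unfolding smooth_vf_on_def by auto
  fix W' and f :: "'m \<Rightarrow> real" assume W': "open W'" "W' \<subseteq> W" "smooth_fun_on \<A> W' f"
  with assms(2) have "smooth_fun_on \<A> W' (\<lambda>y. X y f)" unfolding smooth_vf_on_def by blast
  then show "smooth_fun_on \<A> W' (\<lambda>y. Y y f)"
    by (rule smooth_fun_on_cong[OF W'(1), rotated]) (use assms(1) W'(2) in auto)
qed

lemma smooth_vf_nearI: "open W \<Longrightarrow> x \<in> W \<Longrightarrow> smooth_vf_on \<A> W X \<Longrightarrow> smooth_vf_near \<A> x X"
  unfolding smooth_vf_near_def by blast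

lemma smooth_vf_near_scale:
  assumes "smooth_near \<A> x f" "smooth_vf_near \<A> x X"
  shows "smooth_vf_near \<A> x (\<lambda>y. f y *\<^sub>R X y)"
proof -
  obtain W1 W2 where "open W1" "x \<in> W1" "smooth_fun_on \<A> W1 f" "open W2" "x \<in> W2" "smooth_vf_on \<A> W2 X"
    using assms unfolding smooth_near_def smooth_vf_near_def by blast
  then show ?thesis
    by (intro smooth_vf_nearI[of "W1 \<inter> W2"] smooth_vf_on_scale)
       (auto intro: smooth_fun_on_subset smooth_vf_on_subset)
qed

lemma smooth_vf_near_add:
  assumes "smooth_vf_near \<A> x X" "smooth_vf_near \<A> x Y"
  shows "smooth_vf_near \<A> x (\<lambda>y. X y + Y y)"
proof -
  obtain W1 W2 where "open W1" "x \<in> W1" "smooth_vf_on \<A> W1 X" "open W2" "x \<in> W2" "smooth_vf_on \<A> W2 Y"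
    using assms unfolding smooth_vf_near_def by blast
  then show ?thesis
    by (intro smooth_vf_nearI[of "W1 \<inter> W2"] smooth_vf_on_add) (auto intro: smooth_vf_on_subset)
qed

lemma smooth_vf_near_sum:
  "(\<And>i. i \<in> F \<Longrightarrow> smooth_vf_near \<A> x (X i)) \<Longrightarrow> smooth_vf_near \<A> x (\<lambda>y. \<Sum>i\<in>F. X i y)"
proof (induction F rule: infinite_finite_induct)
  case (insert i F)
  have *: "(\<lambda>y. \<Sum>j\<in>insert i F. X j y) = (\<lambda>y. X i y + (\<Sum>j\<in>F. X j y))"
    using insert(1,2) by (simp only: sum.insert not_False_eq_True)
  show ?case unfolding * by (rule smooth_vf_near_add) (use insert in auto)
qed (simp_all add: smooth_vf_nearI[OF open_UNIV _ smooth_vf_on_zero])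

lemma smooth_vf_near_cong:
  assumes "smooth_vf_near \<A> x X" "eventually (\<lambda>y. X y = Y y) (nhds x)"
  shows "smooth_vf_near \<A> x Y"
proof -
  obtain W1 W2 where W: "open W1" "x \<in> W1" "smooth_vf_on \<A> W1 X" "open W2" "x \<in> W2" "\<And>y. y \<in> W2 \<Longrightarrow> X y = Y y"
    using assms unfolding smooth_vf_near_def eventually_nhds by blast
  have "smooth_vf_on \<A> (W1 \<inter> W2) X" by (rule smooth_vf_on_subset[OF W(3)]) blast
  then have "smooth_vf_on \<A> (W1 \<inter> W2) Y" by (rule smooth_vf_on_cong[rotated]) (simp add: W(6))
  then show ?thesis using W by (intro smooth_vf_nearI[of "W1 \<inter> W2"]) auto
qed

section \<open>Coordinate vector fields\<close>

text \<open>
  Tangent vectors are required to vanish on functions that are not smooth near the base point, which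
  forces the case distinction.
\<close>

definition coordinate_vf :: "'m set \<Rightarrow> ('m \<Rightarrow> 'e) \<Rightarrow> 'e \<Rightarrow> 'm \<Rightarrow> 'm tvec" where
  "coordinate_vf U \<phi> e y =
     (\<lambda>f. if smooth_near \<A> y f then frechet_derivative (f \<circ> inv_into U \<phi>) (at (\<phi> y)) e else 0)"

lemma chart_derivative:
  fixes f :: "'m \<Rightarrow> real"
  assumes "(U, \<phi>) \<in> \<A>" "y \<in> U" "smooth_near \<A> y f"
  shows "((f \<circ> inv_into U \<phi>) has_derivative frechet_derivative (f \<circ> inv_into U \<phi>) (at (\<phi> y))) (at (\<phi> y))"
proof -
  obtain W where W: "open W" "y \<in> W" "smooth_fun_on \<A> W f"
    using assms(3) unfolding smooth_near_def by blast
  have "Ck_on (Suc 0) (\<phi> ` (U \<inter> W)) (f \<circ> inv_into U \<phi>)"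
    using W(3) assms(1) unfolding smooth_fun_on_def smooth_on_def by blast
  then have "(f \<circ> inv_into U \<phi>) differentiable at (\<phi> y)"
    using W(2) assms(2) unfolding Ck_on.simps differentiable_def by blast
  then show ?thesis by (simp add: frechet_derivative_works)
qed

lemma coordinate_vf_tangent:
  assumes c: "(U, \<phi>) \<in> \<A>" and y: "y \<in> U"
  shows "coordinate_vf U \<phi> e y \<in> tangent_space \<A> y"
proof -
  let ?d = "\<lambda>f. frechet_derivative (f \<circ> inv_into U \<phi>) (at (\<phi> y))"
  note d = chart_derivative[OF c y]
  have [simp]: "inv_into U \<phi> (\<phi> y) = y" by (rule inv_into_chart[OF c y])
  have "?d (\<lambda>y. f y + h y) e = ?d f e + ?d h e" if "smooth_near \<A> y f" "smooth_near \<A> y h" for f h :: "'m \<Rightarrow> real"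
    using has_derivative_add[OF d[OF that(1)] d[OF that(2)], THEN frechet_derivative_at]
    by (simp add: comp_def fun_eq_iff)
  moreover have "?d (\<lambda>y. k * f y) e = k * ?d f e" if "smooth_near \<A> y f" for f :: "'m \<Rightarrow> real" and k :: real
    using has_derivative_mult_right[OF d[OF that(1)], of k, THEN frechet_derivative_at]
    by (simp add: comp_def fun_eq_iff)
  moreover have "?d (\<lambda>y. f y * h y) e = f y * ?d h e + h y * ?d f e"
    if "smooth_near \<A> y f" "smooth_near \<A> y h" for f h :: "'m \<Rightarrow> real"
    using has_derivative_mult[OF d[OF that(1)] d[OF that(2)], THEN frechet_derivative_at]
    by (simp add: comp_def fun_eq_iff mult.commute)
  ultimately show ?thesis
    unfolding tangent_space_def coordinate_vf_def
    by (auto simp: smooth_near_add smooth_near_mult smooth_near_const)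
qed

text \<open>
  In its own chart the field applied to \<open>f\<close> is a directional derivative of a smooth function. In any
  other chart this function is composed with a transition map.
\<close>

lemma smooth_coordinate_vf:
  assumes c: "(U, \<phi>) \<in> \<A>"
  shows "smooth_vf_on \<A> U (coordinate_vf U \<phi> e)"
  unfolding smooth_vf_on_def
proof (intro conjI ballI allI impI coordinate_vf_tangent[OF c])
  fix W and f :: "'m \<Rightarrow> real" assume W: "open W" "W \<subseteq> U" and f: "smooth_fun_on \<A> W f"
  have d: "Ck_on k (\<phi> ` W) (\<lambda>z. frechet_derivative (f \<circ> inv_into U \<phi>) (at z) e)" for k
  proof -
    have img: "U \<inter> W = W" using W(2) by (simp add: Int_absorb1)
    have "Ck_on (Suc k) (\<phi> ` (U \<inter> W)) (f \<circ> inv_into U \<phi>)"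
      using f c unfolding smooth_fun_on_def smooth_on_def by blast
    then obtain f' where f': "\<And>z. z \<in> \<phi> ` W \<Longrightarrow> ((f \<circ> inv_into U \<phi>) has_derivative f' z) (at z)"
      "Ck_on k (\<phi> ` W) (\<lambda>z. f' z e)" unfolding img Ck_on.simps by blast
    have op: "open (\<phi> ` W)" using open_chart_image[OF c W(1)] unfolding img .
    show ?thesis
      by (rule Ck_on_cong[OF op _ f'(2)]) (simp add: frechet_derivative_at[OF f'(1)])
  qed
  have "smooth_fun_on \<A> W (\<lambda>y. frechet_derivative (f \<circ> inv_into U \<phi>) (at (\<phi> y)) e)"
    unfolding smooth_fun_on_def smooth_on_def comp_def
  proof clarify
    fix V \<psi> k assume c': "(V, \<psi>) \<in> \<A>"
    have "Ck_on k (\<psi> ` (V \<inter> U)) (\<lambda>z. \<phi> (inv_into V \<psi> z))"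
      using transition_smooth[OF c' c] unfolding smooth_on_def by blast
    then have "Ck_on k (\<psi> ` (V \<inter> W)) (\<lambda>z. \<phi> (inv_into V \<psi> z))"
      by (rule Ck_on_subset) (use W(2) in auto)
    then show "Ck_on k (\<psi> ` (V \<inter> W))
        (\<lambda>z. frechet_derivative (\<lambda>z. f (inv_into U \<phi> z)) (at (\<phi> (inv_into V \<psi> z))) e)"
      by (rule Ck_on_compose[OF d[unfolded comp_def]]) (use inv_into_chart[OF c'] in auto)
  qed
  then show "smooth_fun_on \<A> W (\<lambda>y. coordinate_vf U \<phi> e y f)"
    by (rule smooth_fun_on_cong[OF W(1), rotated])
       (simp add: coordinate_vf_def smooth_nearI[OF W(1) _ f])
qed

lemma coordinate_vf_nonzero:
  assumes c: "(U, \<phi>) \<in> \<A>" and y: "y \<in> U" and e: "e \<noteq> 0"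
  shows "coordinate_vf U \<phi> e y \<noteq> 0"
proof -
  let ?f = "\<lambda>y. \<phi> y \<bullet> e"
  have "smooth_fun_on \<A> U ?f" unfolding smooth_fun_on_def smooth_on_def comp_def
    using transition_smooth[OF _ c] unfolding smooth_on_def by (auto intro: Ck_on_inner)
  then have f: "smooth_near \<A> y ?f" by (rule smooth_nearI[OF open_chart_domain[OF c] y])
  have "((?f \<circ> inv_into U \<phi>) has_derivative (\<lambda>z. z \<bullet> e)) (at (\<phi> y))"
  proof (rule has_derivative_transform_within_open)
    show "((\<lambda>z. z \<bullet> e) has_derivative (\<lambda>z. z \<bullet> e)) (at (\<phi> y))"
      by (intro derivative_eq_intros) auto
    show "open (\<phi> ` U)" "\<phi> y \<in> \<phi> ` U" using open_chart_range[OF c] y by auto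
    show "z \<bullet> e = (?f \<circ> inv_into U \<phi>) z" if "z \<in> \<phi> ` U" for z
      using that by (auto simp: inv_into_chart[OF c])
  qed
  then have "coordinate_vf U \<phi> e y ?f = e \<bullet> e"
    using f unfolding coordinate_vf_def by (simp add: frechet_derivative_at[symmetric])
  then show ?thesis using e by auto
qed

text \<open>
  One nonvanishing field \<open>E\<close> is enough to recover the coefficients of an endomorphism in the span of
  \<open>I\<^sub>1, I\<^sub>2, I\<^sub>3\<close>, because \<open>I\<^sub>1 E, I\<^sub>2 E, I\<^sub>3 E\<close> are orthogonal wherever \<open>E \<noteq> 0\<close>.
\<close>

lemma nonvanishing_vf:
  obtains W E where "open W" "x \<in> W" "smooth_vf_on \<A> W E" "\<And>y. y \<in> W \<Longrightarrow> E y \<noteq> 0"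
proof -
  obtain U \<phi> where c: "(U, \<phi>) \<in> \<A>" "x \<in> U" by (rule chart_at)
  obtain e :: 'e where e: "e \<in> Basis" using nonempty_Basis by blast
  show ?thesis
    by (rule that[OF open_chart_domain[OF c(1)] c(2) smooth_coordinate_vf[OF c(1), of e]])
       (rule coordinate_vf_nonzero[OF c(1) _ nonzero_Basis[OF e]])
qed

end

section \<open>Connections\<close>

locale affine_manifold = smooth_manifold \<A>
  for \<A> :: "('m::{t2_space, second_countable_topology}, 'e::euclidean_space) atlas" +
  fixes nab :: "'m connection"
  assumes affine: "affine_connection \<A> nab"
begin

context
  fixes x D assumes D: "D \<in> tangent_space \<A> x"
begin

lemma
  assumes Y: "smooth_vf_near \<A> x Y"
  shows nab_add: "smooth_vf_near \<A> x Z \<Longrightarrow> nab x D (\<lambda>y. Y y + Z y) = nab x D Y + nab x D Z"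
    and nab_scale: "smooth_near \<A> x f \<Longrightarrow> nab x D (\<lambda>y. f y *\<^sub>R Y y) = D f *\<^sub>R Y x + f x *\<^sub>R nab x D Y"
proof -
  note a = affine[unfolded affine_connection_def, THEN conjunct1, rule_format, OF D D Y]
  show "nab x D (\<lambda>y. Y y + Z y) = nab x D Y + nab x D Z" if "smooth_vf_near \<A> x Z"
    using a[OF that smooth_near_const] by blast
  show "nab x D (\<lambda>y. f y *\<^sub>R Y y) = D f *\<^sub>R Y x + f x *\<^sub>R nab x D Y" if "smooth_near \<A> x f"
    using a[OF Y that] by blast
qed

lemma nab_zero: "nab x D (\<lambda>_. 0) = 0"
proof -
  have z: "smooth_vf_near \<A> x (\<lambda>_. 0)" using smooth_vf_nearI[OF open_UNIV _ smooth_vf_on_zero] by simp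
  show ?thesis using nab_add[OF z z] by simp
qed

text \<open>
  The argument is that of \<open>derivation_cong\<close>: the difference of the two fields equals its product with
  the indicator of the complement of a neighbourhood, a function that vanishes at \<open>x\<close> like the
  difference itself.
\<close>

lemma nab_cong:
  assumes Y: "smooth_vf_near \<A> x Y" and ev: "eventually (\<lambda>y. Y y = Z y) (nhds x)"
  shows "nab x D Y = nab x D Z"
proof -
  have Z: "smooth_vf_near \<A> x Z" by (rule smooth_vf_near_cong[OF Y ev])
  have mZ: "smooth_vf_near \<A> x (\<lambda>y. (- 1) *\<^sub>R Z y)" by (rule smooth_vf_near_scale[OF smooth_near_const Z])
  define X where "X = (\<lambda>y. Y y + (- 1) *\<^sub>R Z y)"
  have X: "smooth_vf_near \<A> x X" unfolding X_def by (rule smooth_vf_near_add[OF Y mZ])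
  obtain W where W: "open W" "x \<in> W" "\<And>y. y \<in> W \<Longrightarrow> Y y = Z y" using ev unfolding eventually_nhds by blast
  define i where "i = (\<lambda>y. if y \<in> W then 0 else 1 :: real)"
  have i: "smooth_near \<A> x i" unfolding i_def by (rule smooth_near_indicator[OF W(1,2)])
  have "X = (\<lambda>y. i y *\<^sub>R X y)" using W(3) by (auto simp: i_def X_def)
  then have "nab x D X = nab x D (\<lambda>y. i y *\<^sub>R X y)" by simp
  also have "\<dots> = 0" using nab_scale[OF X i] W by (simp add: i_def X_def)
  finally have "nab x D X = 0" .
  moreover have "nab x D X = nab x D Y + nab x D (\<lambda>y. (- 1) *\<^sub>R Z y)"
    unfolding X_def by (rule nab_add[OF Y mZ])
  moreover have "nab x D (\<lambda>y. (- 1) *\<^sub>R Z y) = - nab x D Z"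
    using nab_scale[OF Z smooth_near_const[of x "-1"]] derivation_const[OF D] by simp
  ultimately show ?thesis by simp
qed

lemma nab_comb:
  assumes "\<And>i. i \<in> F \<Longrightarrow> smooth_near \<A> x (f i)" "\<And>i. i \<in> F \<Longrightarrow> smooth_vf_near \<A> x (X i)"
  shows "nab x D (\<lambda>y. \<Sum>i\<in>F. f i y *\<^sub>R X i y) = (\<Sum>i\<in>F. D (f i) *\<^sub>R X i x + f i x *\<^sub>R nab x D (X i))"
  using assms
proof (induction F rule: infinite_finite_induct)
  case (insert i F)
  have *: "(\<lambda>y. \<Sum>j\<in>insert i F. f j y *\<^sub>R X j y) = (\<lambda>y. f i y *\<^sub>R X i y + (\<Sum>j\<in>F. f j y *\<^sub>R X j y))"
    using insert(1,2) by (simp only: sum.insert not_False_eq_True)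
  have "smooth_vf_near \<A> x (\<lambda>y. f i y *\<^sub>R X i y)"
    using insert.prems by (intro smooth_vf_near_scale) auto
  moreover have "smooth_vf_near \<A> x (\<lambda>y. \<Sum>j\<in>F. f j y *\<^sub>R X j y)"
    using insert.prems by (intro smooth_vf_near_sum smooth_vf_near_scale) auto
  ultimately have "nab x D (\<lambda>y. \<Sum>j\<in>insert i F. f j y *\<^sub>R X j y)
      = nab x D (\<lambda>y. f i y *\<^sub>R X i y) + nab x D (\<lambda>y. \<Sum>j\<in>F. f j y *\<^sub>R X j y)"
    unfolding * by (rule nab_add)
  also have "nab x D (\<lambda>y. f i y *\<^sub>R X i y) = D (f i) *\<^sub>R X i x + f i x *\<^sub>R nab x D (X i)"
    using insert.prems by (intro nab_scale) auto
  also have "nab x D (\<lambda>y. \<Sum>j\<in>F. f j y *\<^sub>R X j y) = (\<Sum>i\<in>F. D (f i) *\<^sub>R X i x + f i x *\<^sub>R nab x D (X i))"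
    using insert.prems by (intro insert.IH) auto
  finally show ?case using insert(1,2) by (simp only: sum.insert not_False_eq_True)
qed (simp_all only: sum.infinite sum.empty nab_zero if_True not_False_eq_True)

end

end

section \<open>Oriented 3-planes and graph charts\<close>

lemma sum_fun_apply: "(\<Sum>i\<in>F. f i) u = (\<Sum>i\<in>F. f i u)" for f :: "'i \<Rightarrow> 'a \<Rightarrow> 'b::comm_monoid_add"
  by (induction F rule: infinite_finite_induct) auto

definition mat_comb :: "real^3^3 \<Rightarrow> (3 \<Rightarrow> 'l::real_vector) \<Rightarrow> 3 \<Rightarrow> 'l" where
  "mat_comb C b = (\<lambda>i. \<Sum>j\<in>UNIV. (C $ i $ j) *\<^sub>R b j)"

lemma mat_comb_mult: "mat_comb A (mat_comb C b) = mat_comb (A ** C) b"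
proof
  fix i
  have "mat_comb A (mat_comb C b) i = (\<Sum>j\<in>UNIV. \<Sum>k\<in>UNIV. (A $ i $ j * C $ j $ k) *\<^sub>R b k)"
    by (simp add: mat_comb_def scaleR_sum_right)
  also have "\<dots> = (\<Sum>k\<in>UNIV. \<Sum>j\<in>UNIV. (A $ i $ j * C $ j $ k) *\<^sub>R b k)" by (rule sum.swap)
  finally show "mat_comb A (mat_comb C b) i = mat_comb (A ** C) b i"
    by (simp add: mat_comb_def matrix_matrix_mult_def scaleR_sum_left)
qed

lemma mat_comb_id: "mat_comb (mat 1) b = b"
  by (rule ext) (simp add: mat_comb_def mat_def if_distrib[of "\<lambda>c. c *\<^sub>R _"] cong: if_cong)

lemma oriented_span_eq: "oriented_span b = (\<lambda>C. mat_comb C b) ` {C. det C > 0}"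
  unfolding oriented_span_def mat_comb_def by (auto simp: fun_eq_iff image_iff)

text \<open>
  Arithmetic in the integers mod 3 with representatives 1, 2, 3. The numerals 4, 5, 6 arise when the
  simplifier adds an index and a shift.
\<close>

lemma index3_simps [simp]:
  "(1::3) + 1 = 2" "(1::3) + 2 = 3" "(2::3) + 1 = 3" "(2::3) + 2 = 1" "(3::3) + 1 = 1" "(3::3) + 2 = 2"
  "(4::3) = 1" "(5::3) = 2" "(6::3) = 3"
  by simp_all

text \<open>
  Cramer's rule, with cyclic indices absorbing the signs of the cofactors. Unlike an inverse given by
  a choice operator, the formula shows that the entries depend smoothly on those of \<open>N\<close>.
\<close>

definition cofactor_inverse :: "real^3^3 \<Rightarrow> real^3^3" where
  "cofactor_inverse N = (\<chi> j i. (N $ (i+1) $ (j+1) * N $ (i+2) $ (j+2)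
     - N $ (i+1) $ (j+2) * N $ (i+2) $ (j+1)) / det N)"

lemma cofactor_inverse_mult:
  assumes "det N \<noteq> 0"
  shows "cofactor_inverse N ** N = mat 1"
proof -
  have "(\<Sum>i\<in>UNIV. (N $ (i+1) $ (j+1) * N $ (i+2) $ (j+2) - N $ (i+1) $ (j+2) * N $ (i+2) $ (j+1)) * N $ i $ k)
      = (if j = k then det N else 0)" for j k
    using exhaust_3[of j] exhaust_3[of k] by (elim disjE) (simp_all add: sum_3 det_3 algebra_simps)
  then show ?thesis
    using assms by (simp add: vec_eq_iff matrix_matrix_mult_def cofactor_inverse_def mat_def
      flip: sum_divide_distrib)
qed

lemma det_cofactor_inverse_pos:
  assumes "det N > 0"
  shows "det (cofactor_inverse N) > 0"
proof -
  have "det (cofactor_inverse N) * det N = 1"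
    using cofactor_inverse_mult[of N] assms by (simp flip: det_mul)
  then show ?thesis using assms by (metis zero_less_mult_pos2 zero_less_one)
qed

text \<open>
  One inclusion is multiplicativity of the determinant; the other is the same inclusion for the
  inverse matrix.
\<close>

lemma oriented_span_mat_comb:
  assumes "det C > 0"
  shows "oriented_span (mat_comb C b) = oriented_span b"
proof -
  have sub: "oriented_span (mat_comb C b) \<subseteq> oriented_span b" if "det C > 0" for C and b :: "3 \<Rightarrow> 'a"
    using that unfolding oriented_span_eq by (auto simp: mat_comb_mult det_mul intro: mult_pos_pos)
  have "cofactor_inverse C ** C = mat 1" using assms by (intro cofactor_inverse_mult) simp
  with sub[OF det_cofactor_inverse_pos[OF assms], of "mat_comb C b"] sub[OF assms, of b] show ?thesis
    by (simp add: mat_comb_mult mat_comb_id)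
qed

lemma oriented_span_refl: "b \<in> oriented_span b"
  unfolding oriented_span_eq by (rule image_eqI[of _ _ "mat 1"]) (simp_all add: mat_comb_id)

lemma plane_oriented_span: "plane (oriented_span b) = span (range b)"
proof (rule antisym)
  have "mat_comb C b i \<in> span (range b)" for C i
    unfolding mat_comb_def by (intro span_sum span_scale span_base rangeI)
  then show "plane (oriented_span b) \<subseteq> span (range b)"
    unfolding plane_def oriented_span_eq by (intro span_minimal) auto
  show "span (range b) \<subseteq> plane (oriented_span b)"
    unfolding plane_def by (intro span_mono) (use oriented_span_refl in blast)
qed

lemma mem_orthogonal_comp_span: "w \<in> (span S)\<^sup>\<bottom> \<longleftrightarrow> (\<forall>s\<in>S. s \<bullet> w = 0)"
proof
  assume "\<forall>s\<in>S. s \<bullet> w = 0"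
  then have "orthogonal w y" if "y \<in> span S" for y
    using orthogonal_to_span[OF that, of w] by (simp add: orthogonal_def inner_commute)
  then show "w \<in> (span S)\<^sup>\<bottom>" by (simp add: orthogonal_comp_def orthogonal_commute)
qed (auto simp: orthogonal_comp_def orthogonal_def intro: span_base)

text \<open>
  The matrix \<open>N\<close> describes the orthogonal projection of \<open>B\<close> to the plane of \<open>v\<close>, so \<open>c\<close> is the basis of
  the plane of \<open>B\<close> that projects to \<open>v\<close>. A plane on which the projection is an orientation preserving
  isomorphism is the graph of a unique linear map, and a graph over \<open>v\<close> contains \<open>v\<^sub>j + L v\<^sub>j\<close> as its
  vector over \<open>v\<^sub>j\<close>: hence \<open>L v\<^sub>j = c\<^sub>j - v\<^sub>j\<close>.
\<close>

lemma graph_chart_eq: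
  assumes ortho: "\<And>i j. v i \<bullet> v j = (if i = j then 1 else 0)"
    and N: "N = (\<chi> i j. B i \<bullet> v j)" "det N > 0"
    and c: "c = mat_comb (cofactor_inverse N) B"
  shows "graph_chart (oriented_span v) (oriented_span B) = (\<lambda>w. \<Sum>j\<in>UNIV. (v j \<bullet> w) *\<^sub>R (c j - v j))"
proof -
  define L where "L = (\<lambda>w. \<Sum>j\<in>UNIV. (v j \<bullet> w) *\<^sub>R (c j - v j))"
  let ?V = "oriented_span v"
  have inv: "cofactor_inverse N ** N = mat 1" using N(2) by (intro cofactor_inverse_mult) simp
  have span_c: "oriented_span B = oriented_span c"
    unfolding c by (rule oriented_span_mat_comb[OF det_cofactor_inverse_pos[OF N(2)], symmetric])
  have "c i \<bullet> v j = (cofactor_inverse N ** N) $ i $ j" for i j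
    unfolding c mat_comb_def N(1) matrix_matrix_mult_def by (simp add: inner_sum_left)
  then have cv: "c i \<bullet> v j = (if i = j then 1 else 0)" for i j by (simp add: inv mat_def)
  have perp: "w \<in> (plane ?V)\<^sup>\<bottom> \<longleftrightarrow> (\<forall>i. v i \<bullet> w = 0)" for w
    by (simp add: plane_oriented_span mem_orthogonal_comp_span)
  have lin: "linear L"
    unfolding L_def by (rule linearI) (simp_all add: inner_add_right scaleR_add_left sum.distrib scaleR_sum_right)
  have "v i \<bullet> (c j - v j) = 0" for i j
    using cv[of j i] ortho[of i j] by (auto simp: inner_diff_right inner_commute)
  then have "L w \<in> (plane ?V)\<^sup>\<bottom>" for w
    unfolding perp L_def by (simp add: inner_sum_right)
  then have L: "L \<in> grassmann_tangent ?V"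
    using lin by (auto simp: grassmann_tangent_def perp L_def)
  have Lv: "L (v i) = c i - v i" for i
    unfolding L_def by (simp add: ortho if_distrib[of "\<lambda>c. c *\<^sub>R _"] cong: if_cong)
  then have "mat_comb D v i + L (mat_comb D v i) = mat_comb D c i" for D i
    by (simp add: mat_comb_def linear_sum[OF lin] linear_cmul[OF lin] Lv scaleR_diff_right sum_subtractf)
  then have graph: "oriented_graph ?V L = oriented_span B"
    unfolding oriented_graph_def span_c unfolding oriented_span_eq image_image by simp
  show ?thesis unfolding graph_chart_def L_def[symmetric]
  proof (rule the_equality)
    fix L' assume L': "L' \<in> grassmann_tangent ?V \<and> oriented_graph ?V L' = oriented_span B"
    then have lin': "linear L'" and perp': "\<And>w. w \<in> plane ?V \<Longrightarrow> L' w \<in> (plane ?V)\<^sup>\<bottom>"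
      and zero': "\<And>w. w \<in> (plane ?V)\<^sup>\<bottom> \<Longrightarrow> L' w = 0"
      unfolding grassmann_tangent_def by auto
    have "(\<lambda>i. v i + L' (v i)) \<in> oriented_graph ?V L'"
      unfolding oriented_graph_def using oriented_span_refl by blast
    then obtain D where D: "\<And>i. v i + L' (v i) = mat_comb D c i"
      using L' unfolding span_c unfolding oriented_span_eq by (auto simp: fun_eq_iff)
    have "v i \<in> plane ?V" for i by (simp add: plane_oriented_span span_base)
    then have "v k \<bullet> L' (v i) = 0" for i k using perp' perp by blast
    then have "v k \<bullet> mat_comb D c i = (if k = i then 1 else 0)" for i k
      by (simp add: D[symmetric] inner_add_right ortho)
    moreover have "v k \<bullet> mat_comb D c i = D $ i $ k" for i k
      by (simp add: mat_comb_def inner_sum_right inner_commute[of "v k"] cv if_distrib cong: if_cong)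
    ultimately have "D $ i $ k = (if k = i then 1 else 0)" for i k by metis
    then have "D = mat 1" by (auto simp: vec_eq_iff mat_def)
    then have L'v: "L' (v i) = c i - v i" for i
      using D[of i] by (simp add: mat_comb_id algebra_simps)
    show "L' = L"
    proof
      fix w
      let ?p = "\<Sum>j\<in>UNIV. (v j \<bullet> w) *\<^sub>R v j"
      have "v i \<bullet> (w - ?p) = 0" for i
        by (simp add: inner_diff_right inner_sum_right ortho if_distrib cong: if_cong)
      then have "L' (w - ?p) = 0" using zero' perp by blast
      then have "L' w = L' ?p" using linear_diff[OF lin'] by simp
      then show "L' w = L w" by (simp add: linear_sum[OF lin'] linear_cmul[OF lin'] L'v L_def)
    qed
  qed (use L graph in blast)
qed

lemma grassmann_metric_tensor_sum:
  fixes v :: "'i::finite \<Rightarrow> 'l::euclidean_space"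
  assumes "\<And>i j. v i \<bullet> v j = (if i = j then 1 else 0)"
  shows "grassmann_metric (\<Sum>i\<in>UNIV. tensor (v i) (p i)) (\<Sum>j\<in>UNIV. tensor (v j) (q j)) = (\<Sum>i\<in>UNIV. p i \<bullet> q i)"
proof -
  have "grassmann_metric (\<Sum>i\<in>UNIV. tensor (v i) (p i)) (\<Sum>j\<in>UNIV. tensor (v j) (q j))
      = (\<Sum>b\<in>Basis. \<Sum>j\<in>UNIV. \<Sum>i\<in>UNIV. tensor (v i) (p i) b \<bullet> tensor (v j) (q j) b)"
    by (simp add: grassmann_metric_def sum_fun_apply inner_sum_left inner_sum_right)
  also have "\<dots> = (\<Sum>j\<in>UNIV. \<Sum>b\<in>Basis. \<Sum>i\<in>UNIV. tensor (v i) (p i) b \<bullet> tensor (v j) (q j) b)"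
    by (rule sum.swap)
  also have "\<dots> = (\<Sum>j\<in>UNIV. \<Sum>i\<in>UNIV. grassmann_metric (tensor (v i) (p i)) (tensor (v j) (q j)))"
    unfolding grassmann_metric_def by (rule sum.cong[OF refl], rule sum.swap)
  also have "\<dots> = (\<Sum>j\<in>UNIV. \<Sum>i\<in>UNIV. if i = j then p i \<bullet> q j else 0)"
    by (simp add: grassmann_metric_tensor assms if_distrib[of "\<lambda>c. c * _"] cong: if_cong)
  finally show ?thesis by simp
qed

section \<open>Quaternionic vector spaces\<close>

lemma span_range_finite:
  fixes a :: "'i::finite \<Rightarrow> 'v::real_vector"
  assumes "z \<in> span (range a)"
  obtains c where "z = (\<Sum>j\<in>UNIV. c j *\<^sub>R a j)"
proof -
  have "subspace {z. \<exists>c. z = (\<Sum>j\<in>UNIV. c j *\<^sub>R a j)}" (is "subspace ?S")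
  proof (rule subspaceI)
    show "0 \<in> ?S" by (auto intro!: exI[of _ "\<lambda>_. 0"])
    show "y + z \<in> ?S" if y: "y \<in> ?S" and z: "z \<in> ?S" for y z
    proof -
      obtain c d where "y = (\<Sum>j\<in>UNIV. c j *\<^sub>R a j)" "z = (\<Sum>j\<in>UNIV. d j *\<^sub>R a j)" using y z by blast
      then have "y + z = (\<Sum>j\<in>UNIV. (c j + d j) *\<^sub>R a j)" by (simp add: scaleR_add_left sum.distrib)
      then show ?thesis unfolding mem_Collect_eq by (rule exI[of _ "\<lambda>j. c j + d j"])
    qed
    show "k *\<^sub>R y \<in> ?S" if y: "y \<in> ?S" for k y
    proof -
      obtain c where "y = (\<Sum>j\<in>UNIV. c j *\<^sub>R a j)" using y by blast
      then have "k *\<^sub>R y = (\<Sum>j\<in>UNIV. (k * c j) *\<^sub>R a j)" by (simp add: scaleR_sum_right)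
      then show ?thesis unfolding mem_Collect_eq by (rule exI[of _ "\<lambda>j. k * c j"])
    qed
  qed
  moreover have "a i \<in> ?S" for i
    by (auto intro!: exI[of _ "\<lambda>j. if j = i then 1 else 0"] simp: if_distrib[of "\<lambda>c. c *\<^sub>R _"] cong: if_cong)
  ultimately have "span (range a) \<subseteq> ?S" by (intro span_minimal) auto
  then show ?thesis using assms that by blast
qed

text \<open>
  What a quaternionic frame induces on one tangent space. The carrier \<open>T\<close> is a set because tangent
  vectors are particular elements of a larger vector space.
\<close>

locale quaternionic_space =
  fixes T :: "'v::real_vector set" and h :: "'v \<Rightarrow> 'v \<Rightarrow> real" and J :: "3 \<Rightarrow> 'v \<Rightarrow> 'v"
  assumes subspace: "subspace T"
    and metric_add: "u \<in> T \<Longrightarrow> v \<in> T \<Longrightarrow> w \<in> T \<Longrightarrow> h (u + v) w = h u w + h v w"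
    and metric_scale: "u \<in> T \<Longrightarrow> w \<in> T \<Longrightarrow> h (c *\<^sub>R u) w = c * h u w"
    and metric_sym: "u \<in> T \<Longrightarrow> w \<in> T \<Longrightarrow> h u w = h w u"
    and metric_pos: "u \<in> T \<Longrightarrow> u \<noteq> 0 \<Longrightarrow> h u u > 0"
    and J_closed: "u \<in> T \<Longrightarrow> J i u \<in> T"
    and J_add: "u \<in> T \<Longrightarrow> v \<in> T \<Longrightarrow> J i (u + v) = J i u + J i v"
    and J_scale: "u \<in> T \<Longrightarrow> J i (c *\<^sub>R u) = c *\<^sub>R J i u"
    and J_square: "u \<in> T \<Longrightarrow> J i (J i u) = - u"
    and J_cyclic: "u \<in> T \<Longrightarrow> J i (J (i + 1) u) = J (i + 2) u"
    and J_isometry: "u \<in> T \<Longrightarrow> v \<in> T \<Longrightarrow> h (J i u) (J i v) = h u v"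
begin

lemma metric_zero: "w \<in> T \<Longrightarrow> h 0 w = 0"
  using metric_scale[of 0 w 0] subspace_0[OF subspace] by simp

lemma metric_sum:
  assumes "\<And>i. i \<in> F \<Longrightarrow> a i \<in> T" "w \<in> T"
  shows "h (\<Sum>i\<in>F. c i *\<^sub>R a i) w = (\<Sum>i\<in>F. c i * h (a i) w)"
  using assms
proof (induction F rule: infinite_finite_induct)
  case (insert i F)
  have "c i *\<^sub>R a i \<in> T" "(\<Sum>i\<in>F. c i *\<^sub>R a i) \<in> T"
    using insert.prems by (auto intro!: subspace_sum[OF subspace] subspace_scale[OF subspace])
  then show ?case using insert by (simp add: metric_add metric_scale)
qed (simp_all add: metric_zero)

lemma metric_minus: "u \<in> T \<Longrightarrow> w \<in> T \<Longrightarrow> h (- u) w = - h u w"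
  using metric_scale[of u w "-1"] by simp

lemma J_minus: "u \<in> T \<Longrightarrow> J i (- u) = - J i u"
  using J_scale[of u i "-1"] by simp

lemma metric_J_self: "u \<in> T \<Longrightarrow> h (J i u) u = 0"
  using J_isometry[of "J i u" u i] metric_minus[of u "J i u"] metric_sym[of u "J i u"]
  by (simp add: J_square J_closed)

text \<open>
  Applying the isometry \<open>J\<^sub>i\<close> to both arguments of \<open>h (J\<^sub>i u, J\<^sub>i\<^sub>+\<^sub>1 u)\<close> leaves \<open>- h (u, J\<^sub>i\<^sub>+\<^sub>2 u)\<close>, and
  each \<open>J\<^sub>j\<close> is skew.
\<close>

lemma metric_J_J:
  assumes u: "u \<in> T"
  shows "h (J i u) (J j u) = (if i = j then h u u else 0)"
proof -
  have succ: "h (J i u) (J (i + 1) u) = 0" for i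
  proof -
    have "h (J i u) (J (i + 1) u) = h (J i (J i u)) (J i (J (i + 1) u))"
      using u by (simp add: J_isometry J_closed)
    also have "\<dots> = - h u (J (i + 2) u)"
      using u by (simp add: J_square J_cyclic metric_minus J_closed)
    also have "\<dots> = 0" using u metric_J_self metric_sym J_closed by simp
    finally show ?thesis .
  qed
  have "i = j \<or> j = i + 1 \<or> i = j + 1"
    using exhaust_3[of i] exhaust_3[of j] by auto
  then show ?thesis
    using u succ[of i] succ[of j] J_isometry[of u u i] metric_sym[of "J i u" "J j u"] J_closed[OF u]
    by auto
qed

lemma metric_comb_J:
  "u \<in> T \<Longrightarrow> h (\<Sum>j\<in>UNIV. c j *\<^sub>R J j u) (J i u) = c i * h u u"
  by (simp add: metric_sum J_closed metric_J_J if_distrib cong: if_cong)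

lemma comb_J_inject:
  assumes "u \<in> T" "u \<noteq> 0" "(\<Sum>j\<in>UNIV. c j *\<^sub>R J j u) = (\<Sum>j\<in>UNIV. d j *\<^sub>R J j u)"
  shows "c i = d i"
  using metric_comb_J[OF assms(1), of c i] metric_comb_J[OF assms(1), of d i] assms metric_pos[of u]
  by simp

lemma J_anticyclic:
  assumes u: "u \<in> T"
  shows "J (i + 1) (J i u) = - J (i + 2) u"
proof -
  have "J (i + 1) w = J (i + 2) (J i w)" if "w \<in> T" for w
    using exhaust_3[of i] J_cyclic[OF that, of "i + 2"] by auto
  from this[OF J_closed[OF u]] have "J (i + 1) (J i u) = J (i + 2) (J i (J i u))" .
  then show ?thesis using u by (simp add: J_square J_minus J_closed)
qed

text \<open>
  Let \<open>r\<^sub>1, r\<^sub>2, r\<^sub>3\<close> be the rows of \<open>C\<close>. As for imaginary quaternions,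
  \<open>J'\<^sub>1 J'\<^sub>2 = - (r\<^sub>1 \<bullet> r\<^sub>2) + \<Sum>\<^sub>j (r\<^sub>1 \<times> r\<^sub>2)\<^sub>j J\<^sub>j\<close>, so \<open>J'\<^sub>1 J'\<^sub>2 = J'\<^sub>3\<close> forces \<open>r\<^sub>3 = r\<^sub>1 \<times> r\<^sub>2\<close>. Then
  \<open>det C = r\<^sub>3 \<bullet> (r\<^sub>1 \<times> r\<^sub>2) = |r\<^sub>3|\<^sup>2\<close>, which is 1 because \<open>J'\<^sub>3\<close> is an isometry.
\<close>

lemma change_of_frame_det:
  assumes J': "quaternionic_space T h J'" and u: "u \<in> T" "u \<noteq> 0"
    and C: "\<And>i w. w \<in> T \<Longrightarrow> J' i w = (\<Sum>j\<in>UNIV. (C $ i $ j) *\<^sub>R J j w)"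
  shows "det C = 1"
proof -
  interpret J': quaternionic_space T h J' by (rule J')
  note sc = subspace_scale[OF subspace] and ad = subspace_add[OF subspace]
  have T: "J i u \<in> T" for i using u J_closed by blast
  have pos: "h u u \<noteq> 0" using metric_pos[OF u] by simp
  note tab = J_square[OF u(1)] J_cyclic[OF u(1), of 1, simplified] J_cyclic[OF u(1), of 2, simplified]
    J_cyclic[OF u(1), of 3, simplified] J_anticyclic[OF u(1), of 1, simplified]
    J_anticyclic[OF u(1), of 2, simplified] J_anticyclic[OF u(1), of 3, simplified]
  have "J' 1 (J' 2 u) = J' 3 u" using J'.J_cyclic[OF u(1), of 1] by simp
  \<comment> \<open>The real part and the imaginary part of the product of the first two rows.\<close>
  moreover define r where "r = - (C$1$1 * C$2$1 + C$1$2 * C$2$2 + C$1$3 * C$2$3)"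
  moreover define s :: "3 \<Rightarrow> real" where "s j = (if j = 1 then C$1$2 * C$2$3 - C$1$3 * C$2$2
    else if j = 2 then C$1$3 * C$2$1 - C$1$1 * C$2$3 else C$1$1 * C$2$2 - C$1$2 * C$2$1)" for j
  moreover have "J' 1 (J' 2 u) = r *\<^sub>R u + (\<Sum>j\<in>UNIV. s j *\<^sub>R J j u)"
    unfolding C[OF J'.J_closed[OF u(1)]] unfolding C[OF u(1)]
    by (simp add: sum_3 J_add J_scale T sc ad tab r_def s_def algebra_simps)
  ultimately have eq: "r *\<^sub>R u + (\<Sum>j\<in>UNIV. s j *\<^sub>R J j u) = (\<Sum>j\<in>UNIV. (C $ 3 $ j) *\<^sub>R J j u)"
    by (simp only: C[OF u(1)])
  have "s i = C $ 3 $ i" for i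
  proof -
    have hu: "h u (J i u) = 0" using metric_sym[OF u(1) T] metric_J_self[OF u(1)] by simp
    have S: "r *\<^sub>R u \<in> T" "(\<Sum>j\<in>UNIV. s j *\<^sub>R J j u) \<in> T"
      using u T by (auto intro!: sc subspace_sum[OF subspace])
    have "h (r *\<^sub>R u + (\<Sum>j\<in>UNIV. s j *\<^sub>R J j u)) (J i u) = s i * h u u"
      unfolding metric_add[OF S T] metric_scale[OF u(1) T] metric_comb_J[OF u(1)] hu by simp
    then show ?thesis unfolding eq metric_comb_J[OF u(1)] using pos by simp
  qed
  from this[of 1] this[of 2] this[of 3] have row:
    "C$1$2 * C$2$3 - C$1$3 * C$2$2 = C$3$1" "C$1$3 * C$2$1 - C$1$1 * C$2$3 = C$3$2"
    "C$1$1 * C$2$2 - C$1$2 * C$2$1 = C$3$3" by (simp_all add: s_def)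
  have hJ: "h (J j u) (J' 3 u) = C$3$j * h u u" for j
    unfolding metric_sym[OF T J'.J_closed[OF u(1)]] unfolding C[OF u(1)] by (rule metric_comb_J[OF u(1)])
  have "h u u = h (J' 3 u) (J' 3 u)" using u by (simp add: J'.J_isometry)
  also have "\<dots> = h (\<Sum>j\<in>UNIV. (C$3$j) *\<^sub>R J j u) (J' 3 u)" by (simp add: C[OF u(1)])
  also have "\<dots> = (\<Sum>j\<in>UNIV. C$3$j * h (J j u) (J' 3 u))" using T u by (simp add: metric_sum J'.J_closed)
  also have "\<dots> = (\<Sum>j\<in>UNIV. C$3$j * C$3$j) * h u u"
    by (simp add: hJ sum_distrib_right mult.assoc)
  finally have "(\<Sum>j\<in>UNIV. C$3$j * C$3$j) = 1" using pos by simp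
  moreover have "det C = C$3$1 * (C$1$2 * C$2$3 - C$1$3 * C$2$2) + C$3$2 * (C$1$3 * C$2$1 - C$1$1 * C$2$3)
      + C$3$3 * (C$1$1 * C$2$2 - C$1$2 * C$2$1)"
    by (simp add: det_3 algebra_simps)
  ultimately show ?thesis unfolding row by (simp add: sum_3)
qed

end

section \<open>The moment map\<close>

text \<open>
  \<open>K a\<close> stands for the Killing field of \<open>a\<close>.
\<close>

locale quaternionic_moment = affine_manifold \<A> nab
  for \<A> :: "('m::{t2_space, second_countable_topology}, 'e::euclidean_space) atlas"
    and nab :: "'m connection" +
  fixes g :: "'m metric_tensor" and Q :: "'m \<Rightarrow> 'm tendo set"
    and \<mu> :: "'l::euclidean_space \<Rightarrow> 'm \<Rightarrow> 'm tendo" and K :: "'l \<Rightarrow> 'm \<Rightarrow> 'm tvec"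
  assumes metric: "riemannian_metric \<A> g"
    and mu_linear: "linear (\<lambda>a. \<mu> a x)"
    and mu_smooth: "smooth_endo_on \<A> UNIV (\<mu> a)"
    and mu_in_Q: "\<mu> a x \<in> Q x"
    and mu_deriv: "quaternionic_frame \<A> g Q W I \<Longrightarrow> x \<in> W \<Longrightarrow> D \<in> tangent_space \<A> x \<Longrightarrow>
      has_cov_deriv \<A> nab (\<mu> a) x D (\<Sum>i\<in>UNIV. g x (I i x (K a x)) D *\<^sub>R I i x)"
begin

lemma frame_endo: "quaternionic_frame \<A> g Q W I \<Longrightarrow> y \<in> W \<Longrightarrow> I i y \<in> tangent_endos \<A> y"
  unfolding quaternionic_frame_def smooth_endo_on_def by blast

text \<open>
  Endomorphisms are extended by zero outside the tangent space, so the value is tangent for every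
  \<open>u\<close>, in particular when \<open>u\<close> is the value of \<open>K a\<close> at \<open>y\<close>.
\<close>

lemma frame_closed:
  assumes "quaternionic_frame \<A> g Q W I" "y \<in> W"
  shows "I i y u \<in> tangent_space \<A> y"
  using frame_endo[OF assms, of i] tangent_0[of y] unfolding tangent_endos_def
  by (cases "u \<in> tangent_space \<A> y") auto

lemma frame_quaternionic_space:
  assumes fr: "quaternionic_frame \<A> g Q W I" and y: "y \<in> W"
  shows "quaternionic_space (tangent_space \<A> y) (g y) (\<lambda>i. I i y)"
proof
  note m = metric[unfolded riemannian_metric_def, THEN conjunct1, rule_format]
    and pos = metric[unfolded riemannian_metric_def, THEN conjunct2, THEN conjunct1, rule_format]
  note e = frame_endo[OF fr y, unfolded tangent_endos_def mem_Collect_eq]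
  have f: "\<And>i u. u \<in> tangent_space \<A> y \<Longrightarrow> I i y (I i y u) = - u \<and> I i y (I (i + 1) y u) = I (i + 2) y u \<and>
        (\<forall>v\<in>tangent_space \<A> y. g y (I i y u) (I i y v) = g y u v)"
    using fr y unfolding quaternionic_frame_def by blast
  show "subspace (tangent_space \<A> y)"
    by (rule subspaceI) (auto intro: tangent_0 tangent_add tangent_scale)
  fix u v w i and c :: real
  assume u: "u \<in> tangent_space \<A> y"
  show "g y u u > 0" if "u \<noteq> 0" using pos[OF u that] .
  show "g y (c *\<^sub>R u) w = c * g y u w" "g y u w = g y w u" if w: "w \<in> tangent_space \<A> y"
    using m[OF u u w, of c] m[OF u w w, of c] by simp_all
  show "I i y u \<in> tangent_space \<A> y" "I i y (c *\<^sub>R u) = c *\<^sub>R I i y u" using e[of i] u by simp_all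
  show "I i y (I i y u) = - u" "I i y (I (i + 1) y u) = I (i + 2) y u" using f[OF u, of i] by blast+
  assume v: "v \<in> tangent_space \<A> y"
  show "I i y (u + v) = I i y u + I i y v" using e[of i] u v by simp
  show "g y (I i y u) (I i y v) = g y u v" using f[OF u, of i] v by blast
  assume w: "w \<in> tangent_space \<A> y"
  show "g y (u + v) w = g y u w + g y v w" using m[OF u v w, of 0] by simp
qed

lemma tangent_nonzero: obtains u where "u \<in> tangent_space \<A> x" "u \<noteq> 0"
  using nonvanishing_vf smooth_vf_on_tangent by metis

text \<open>
  The element \<open>\<Sum>\<^sub>i I\<^sub>i \<otimes> B\<^sub>i\<close> is independent of the frame, so the components change by the transpose
  of the matrix that changes the frames.
\<close>

lemma components_change_of_frame:
  assumes IB: "moment_components \<A> g Q \<mu> x I B" and IB': "moment_components \<A> g Q \<mu> x I' B'"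
    and C: "\<And>i u. I' i x u = (\<Sum>j\<in>UNIV. (C $ i $ j) *\<^sub>R I j x u)"
  shows "B = mat_comb (transpose C) B'"
proof
  fix k
  obtain W where W: "x \<in> W" "quaternionic_frame \<A> g Q W I"
    using IB unfolding moment_components_def by blast
  interpret quaternionic_space "tangent_space \<A> x" "g x" "\<lambda>i. I i x"
    by (rule frame_quaternionic_space[OF W(2,1)])
  obtain u where u: "u \<in> tangent_space \<A> x" "u \<noteq> 0" by (rule tangent_nonzero)
  have "B k \<bullet> a = mat_comb (transpose C) B' k \<bullet> a" for a
  proof -
    have "(\<Sum>j\<in>UNIV. (B j \<bullet> a) *\<^sub>R I j x u) = \<mu> a x u"
      using IB unfolding moment_components_def by (simp add: sum_fun_apply)
    also have "\<dots> = (\<Sum>i\<in>UNIV. (B' i \<bullet> a) *\<^sub>R I' i x u)"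
      using IB' unfolding moment_components_def by (simp add: sum_fun_apply)
    also have "\<dots> = (\<Sum>i\<in>UNIV. \<Sum>j\<in>UNIV. ((B' i \<bullet> a) * C $ i $ j) *\<^sub>R I j x u)"
      unfolding C by (simp only: scaleR_sum_right scaleR_scaleR)
    also have "\<dots> = (\<Sum>j\<in>UNIV. \<Sum>i\<in>UNIV. ((B' i \<bullet> a) * C $ i $ j) *\<^sub>R I j x u)" by (rule sum.swap)
    also have "\<dots> = (\<Sum>j\<in>UNIV. (\<Sum>i\<in>UNIV. (B' i \<bullet> a) * C $ i $ j) *\<^sub>R I j x u)"
      by (simp only: scaleR_sum_left)
    finally have "B k \<bullet> a = (\<Sum>i\<in>UNIV. (B' i \<bullet> a) * C $ i $ k)" by (rule comb_J_inject[OF u])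
    then show ?thesis by (simp add: mat_comb_def transpose_def inner_sum_left mult.commute)
  qed
  then show "B k = mat_comb (transpose C) B' k" using vector_eq_rdot by blast
qed

lemma components_unique:
  assumes "moment_components \<A> g Q \<mu> x I B" "moment_components \<A> g Q \<mu> x I B'"
  shows "B = B'"
proof -
  have "I i x u = (\<Sum>j\<in>UNIV. (mat 1 $ i $ j :: real) *\<^sub>R I j x u)" for i u
    using fun_cong[OF mat_comb_id, of "\<lambda>j. I j x u" i] unfolding mat_comb_def ..
  from components_change_of_frame[OF assms this] show ?thesis by (simp add: mat_comb_id transpose_mat)
qed

text \<open>
  Two frames of the same fibre differ by a matrix of determinant 1, hence the components span the
  same oriented plane. This makes the definite description in \<open>\<Psi>\<close> meaningful.
\<close>

lemma components_oriented_span: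
  assumes IB: "moment_components \<A> g Q \<mu> x I B" and IB': "moment_components \<A> g Q \<mu> x I' B'"
  shows "oriented_span B' = oriented_span B"
proof -
  obtain W where W: "x \<in> W" "quaternionic_frame \<A> g Q W I"
    using IB unfolding moment_components_def by blast
  obtain W' where W': "x \<in> W'" "quaternionic_frame \<A> g Q W' I'"
    using IB' unfolding moment_components_def by blast
  interpret quaternionic_space "tangent_space \<A> x" "g x" "\<lambda>i. I i x"
    by (rule frame_quaternionic_space[OF W(2,1)])
  have "span (range (\<lambda>i. I' i x)) = span (range (\<lambda>i. I i x))"
    using W W' unfolding quaternionic_frame_def by metis
  then have mem: "I' i x \<in> span (range (\<lambda>i. I i x))" for i using span_base[of "I' i x" "range (\<lambda>i. I' i x)"] by blast
  have "\<exists>c. I' i x = (\<Sum>j\<in>UNIV. c j *\<^sub>R I j x)" for i by (rule span_range_finite[OF mem]) (rule exI)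
  then have "\<exists>c. \<forall>i. I' i x = (\<Sum>j\<in>UNIV. c i j *\<^sub>R I j x)" by (intro choice allI)
  then obtain c where c: "\<And>i. I' i x = (\<Sum>j\<in>UNIV. c i j *\<^sub>R I j x)" by auto
  define C :: "real^3^3" where "C = (\<chi> i j. c i j)"
  have C: "I' i x u = (\<Sum>j\<in>UNIV. (C $ i $ j) *\<^sub>R I j x u)" for i u
    unfolding c C_def by (simp add: sum_fun_apply)
  obtain u where u: "u \<in> tangent_space \<A> x" "u \<noteq> 0" by (rule tangent_nonzero)
  have "det C = 1"
    by (rule change_of_frame_det[OF frame_quaternionic_space[OF W'(2,1)] u C])
  then show ?thesis
    unfolding components_change_of_frame[OF IB IB' C] by (intro oriented_span_mat_comb[symmetric]) simp
qed

lemma Psi_eq: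
  assumes "moment_components \<A> g Q \<mu> x I B"
  shows "Psi \<A> g Q \<mu> x = oriented_span B"
  unfolding Psi_def
proof (rule the_equality)
  show "\<exists>I' B'. moment_components \<A> g Q \<mu> x I' B' \<and> oriented_span B = oriented_span B'" using assms by blast
  show "P = oriented_span B" if "\<exists>I B. moment_components \<A> g Q \<mu> x I B \<and> P = oriented_span B" for P
    using that components_oriented_span[OF assms] by blast
qed

text \<open>
  The components of the moment map in a fixed frame near \<open>x\<close>. Since \<open>I\<^sub>1 E, I\<^sub>2 E, I\<^sub>3 E\<close> are orthogonal
  of the length of \<open>E\<close>, the coefficient of \<open>I\<^sub>i\<close> in \<open>\<mu>\<^sub>a\<close> is \<open>g (\<mu>\<^sub>a E, I\<^sub>i E) / g (E, E)\<close>; it is smooth, and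
  linear in \<open>a\<close>, so it is the inner product of \<open>a\<close> with a vector \<open>B\<^sub>i\<close>.

  If all coefficients of \<open>\<mu>\<^sub>a\<close> vanish at \<open>x\<close>, then \<open>\<mu>\<^sub>a\<close> does too, and the covariant derivative of
  \<open>\<mu>\<^sub>a\<close> applied to \<open>E\<close> is \<open>\<nabla> (\<mu>\<^sub>a E) = \<Sum>\<^sub>i D (B\<^sub>i \<bullet> a) I\<^sub>i E\<close>. Comparison with the moment map equation,
  coefficient by coefficient, gives the derivatives.
\<close>

lemma moment_coordinates:
  assumes fr: "quaternionic_frame \<A> g Q W I" and x: "x \<in> W"
  obtains B :: "'m \<Rightarrow> 3 \<Rightarrow> 'l" where
    "eventually (\<lambda>y. moment_components \<A> g Q \<mu> y I (B y)) (nhds x)"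
    "\<And>i a. smooth_near \<A> x (\<lambda>y. B y i \<bullet> a)"
    "\<And>i a D. D \<in> tangent_space \<A> x \<Longrightarrow> (\<And>j. B x j \<bullet> a = 0) \<Longrightarrow>
       D (\<lambda>y. B y i \<bullet> a) = g x (I i x (K a x)) D"
proof -
  obtain W0 E where W0: "open W0" "x \<in> W0" "smooth_vf_on \<A> W0 E" "\<And>y. y \<in> W0 \<Longrightarrow> E y \<noteq> 0"
    by (rule nonvanishing_vf[of x]) blast
  define V where "V = W \<inter> W0"
  have "open W" using fr unfolding quaternionic_frame_def by blast
  then have V: "open V" "x \<in> V" using W0 x by (auto simp: V_def)
  have fr_V: "y \<in> W" if "y \<in> V" for y using that by (simp add: V_def)
  have E: "smooth_vf_on \<A> V E" using W0(3) by (rule smooth_vf_on_subset) (simp add: V_def)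
  have IE: "smooth_vf_on \<A> V (\<lambda>y. I i y (E y))" for i
    using fr E V(1) unfolding quaternionic_frame_def smooth_endo_on_def V_def by blast
  have muE: "smooth_vf_on \<A> V (\<lambda>y. \<mu> a y (E y))" for a
    using mu_smooth[of a] E V(1) unfolding smooth_endo_on_def by blast
  have qs: "quaternionic_space (tangent_space \<A> y) (g y) (\<lambda>i. I i y)" if "y \<in> V" for y
    by (rule frame_quaternionic_space[OF fr fr_V[OF that]])
  have ET: "E y \<in> tangent_space \<A> y" if "y \<in> V" for y by (rule smooth_vf_on_tangent[OF E that])
  have EE: "g y (E y) (E y) > 0" if "y \<in> V" for y
    using quaternionic_space.metric_pos[OF qs[OF that] ET[OF that]] that W0(4) by (simp add: V_def)
  define b where "b a i y = g y (\<mu> a y (E y)) (I i y (E y)) / g y (E y) (E y)" for a i y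
  have b_comp: "\<mu> a y = (\<Sum>i\<in>UNIV. b a i y *\<^sub>R I i y)" if y: "y \<in> V" for a y
  proof -
    have "\<mu> a y \<in> span (range (\<lambda>i. I i y))"
      using mu_in_Q[of a y] fr fr_V[OF y] unfolding quaternionic_frame_def by blast
    then obtain c where c: "\<mu> a y = (\<Sum>i\<in>UNIV. c i *\<^sub>R I i y)" by (rule span_range_finite)
    have "b a i y = c i" for i
      unfolding b_def c using quaternionic_space.metric_comb_J[OF qs[OF y] ET[OF y], of c i] EE[OF y]
      by (simp add: sum_fun_apply)
    then show ?thesis using c by simp
  qed
  have b_linear: "linear (\<lambda>a. b a i y)" if y: "y \<in> V" for i y
  proof -
    interpret quaternionic_space "tangent_space \<A> y" "g y" "\<lambda>i. I i y" by (rule qs[OF y])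
    have T: "\<mu> a y (E y) \<in> tangent_space \<A> y" for a by (rule smooth_vf_on_tangent[OF muE y])
    show ?thesis
    proof (rule linearI)
      show "b (a + a') i y = b a i y + b a' i y" for a a'
        unfolding b_def linear_add[OF mu_linear] plus_fun_apply metric_add[OF T T J_closed[OF ET[OF y]]]
        by (rule add_divide_distrib)
      show "b (c *\<^sub>R a) i y = c *\<^sub>R b a i y" for c a
        unfolding b_def linear_cmul[OF mu_linear] scaleR_fun_apply metric_scale[OF T J_closed[OF ET[OF y]]]
        by simp
    qed
  qed
  \<comment> \<open>The adjoint at 1 is the vector that represents a linear functional.\<close>
  define B where "B y i = adjoint (\<lambda>a. b a i y) 1" for y i
  have B: "B y i \<bullet> a = b a i y" if "y \<in> V" for y i a
    using adjoint_works[OF b_linear[OF that, of i], of a 1] by (simp add: B_def inner_commute)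
  have comp: "moment_components \<A> g Q \<mu> y I (B y)" if "y \<in> V" for y
    unfolding moment_components_def using fr fr_V[OF that] b_comp[OF that] B[OF that] by auto
  have ev: "eventually (\<lambda>y. y \<in> V) (nhds x)" using V eventually_nhds_in_open by blast
  have smg: "smooth_fun_on \<A> V (\<lambda>y. g y (X y) (Y y))" if "smooth_vf_on \<A> V X" "smooth_vf_on \<A> V Y" for X Y
    using metric V(1) that unfolding riemannian_metric_def by blast
  have b_smooth: "smooth_near \<A> x (\<lambda>y. b a i y)" for a i
    unfolding b_def using EE[OF V(2)]
    by (intro smooth_near_divide smooth_nearI[OF V] smg muE IE E) simp
  have sm: "smooth_near \<A> x (\<lambda>y. B y i \<bullet> a)" for i a
    by (rule smooth_near_cong[OF b_smooth[of a i]], rule eventually_mono[OF ev]) (simp add: B)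
  show ?thesis
  proof (rule that)
    show "eventually (\<lambda>y. moment_components \<A> g Q \<mu> y I (B y)) (nhds x)"
      using ev by (rule eventually_mono) (rule comp)
    show "smooth_near \<A> x (\<lambda>y. B y i \<bullet> a)" for i a by (rule sm)
    fix i a D assume D: "D \<in> tangent_space \<A> x" and 0: "\<And>j. B x j \<bullet> a = 0"
    have Enear: "smooth_vf_near \<A> x E" by (rule smooth_vf_nearI[OF V E])
    have mu0: "\<mu> a x = 0" using b_comp[OF V(2), of a] 0 B[OF V(2)] by simp
    let ?K = "\<Sum>i\<in>UNIV. g x (I i x (K a x)) D *\<^sub>R I i x"
    have "?K (E x) = nab x D (\<lambda>y. \<mu> a y (E y)) - \<mu> a x (nab x D E)"
      using mu_deriv[OF fr x D, of a] Enear unfolding has_cov_deriv_def by blast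
    also have "\<dots> = nab x D (\<lambda>y. \<mu> a y (E y))" by (simp add: mu0)
    also have "\<dots> = nab x D (\<lambda>y. \<Sum>i\<in>UNIV. (B y i \<bullet> a) *\<^sub>R I i y (E y))"
      by (rule nab_cong[OF D smooth_vf_nearI[OF V muE]], rule eventually_mono[OF ev])
         (simp add: b_comp B sum_fun_apply)
    also have "\<dots> = (\<Sum>i\<in>UNIV. D (\<lambda>y. B y i \<bullet> a) *\<^sub>R I i x (E x) + (B x i \<bullet> a) *\<^sub>R nab x D (\<lambda>y. I i y (E y)))"
      by (rule nab_comb[OF D sm smooth_vf_nearI[OF V IE]])
    also have "\<dots> = (\<Sum>i\<in>UNIV. D (\<lambda>y. B y i \<bullet> a) *\<^sub>R I i x (E x))" by (simp add: 0)
    finally have "(\<Sum>i\<in>UNIV. g x (I i x (K a x)) D *\<^sub>R I i x (E x))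
        = (\<Sum>i\<in>UNIV. D (\<lambda>y. B y i \<bullet> a) *\<^sub>R I i x (E x))" by (simp add: sum_fun_apply)
    then have "g x (I i x (K a x)) D = D (\<lambda>y. B y i \<bullet> a)"
      using W0(2,4) by (intro quaternionic_space.comb_J_inject[OF qs[OF V(2)] ET[OF V(2)]]) auto
    then show "D (\<lambda>y. B y i \<bullet> a) = g x (I i x (K a x)) D" ..
  qed
qed

text \<open>
  In the graph chart \<open>\<Psi>\<close> is \<open>y \<mapsto> \<Sum>\<^sub>j v\<^sub>j \<otimes> (c\<^sub>j(y) - v\<^sub>j)\<close>, where \<open>c\<^sub>j = \<Sum>\<^sub>k R\<^sub>j\<^sub>k B\<^sub>k\<close> and \<open>R\<close> is the
  inverse of the matrix \<open>N\<close> of inner products \<open>B\<^sub>k \<bullet> v\<^sub>j\<close>. So \<open>q\<^sub>j\<close> is the derivative of \<open>c\<^sub>j\<close>. In the direction of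
  \<open>p \<bottom> V\<close> the derivative of \<open>R\<close> does not contribute, because \<open>B\<^sub>k \<bullet> p\<close> vanishes at \<open>x\<close>, and
  \<open>R(x) = 1/l\<close>.
\<close>

lemma Psi_differential:
  assumes mu_x: "moment_components \<A> g Q \<mu> x I (\<lambda>i. l *\<^sub>R v i)" and l: "l > 0"
    and ortho: "\<And>i j. v i \<bullet> v j = (if i = j then 1 else 0)"
    and Z: "Z \<in> tangent_space \<A> x"
  obtains q where "grassmann_differential (Psi \<A> g Q \<mu>) x Z = (\<Sum>j\<in>UNIV. tensor (v j) (q j))"
    "\<And>j p. p \<in> (plane (Psi \<A> g Q \<mu> x))\<^sup>\<bottom> \<Longrightarrow> p \<bullet> q j = (1 / l) * g x (I j x (K p x)) Z"
proof -
  obtain W where W: "x \<in> W" "quaternionic_frame \<A> g Q W I"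
    using mu_x unfolding moment_components_def by blast
  obtain B where B: "eventually (\<lambda>y. moment_components \<A> g Q \<mu> y I (B y)) (nhds x)"
    and B_smooth: "\<And>i a. smooth_near \<A> x (\<lambda>y. B y i \<bullet> a)"
    and B_deriv: "\<And>i a D. D \<in> tangent_space \<A> x \<Longrightarrow> (\<And>j. B x j \<bullet> a = 0) \<Longrightarrow>
       D (\<lambda>y. B y i \<bullet> a) = g x (I i x (K a x)) D"
    by (rule moment_coordinates[OF W(2,1)]) blast
  have Bx: "B x i = l *\<^sub>R v i" for i
    using components_unique[OF eventually_nhds_x_imp_x[OF B] mu_x] by (rule fun_cong)
  have "mat_comb (\<chi> i j. if i = j then l else 0) v = B x"
    by (rule ext) (simp add: Bx mat_comb_def if_distrib[of "\<lambda>c. c *\<^sub>R _"] cong: if_cong)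
  moreover have "det (\<chi> i j. if i = j then l else 0 :: real^3^3) > 0" using l by (simp add: det_3)
  ultimately have Psi_x: "Psi \<A> g Q \<mu> x = oriented_span v"
    using Psi_eq[OF eventually_nhds_x_imp_x[OF B]] oriented_span_mat_comb by metis
  define N :: "'m \<Rightarrow> real^3^3" where "N y = (\<chi> i j. B y i \<bullet> v j)" for y
  have N_smooth: "smooth_near \<A> x (\<lambda>y. N y $ i $ j)" for i j by (simp add: N_def B_smooth)
  have det_smooth: "smooth_near \<A> x (\<lambda>y. det (N y))"
    unfolding det_3 by (intro smooth_near_add smooth_near_diff smooth_near_mult N_smooth)
  have Nx: "N x $ i $ j = (if i = j then l else 0)" for i j by (simp add: N_def Bx ortho)
  have det_x: "det (N x) > 0" using l by (simp add: det_3 Nx)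
  then have "eventually (\<lambda>y. det (N y) > 0) (at x)"
    using smooth_near_isCont[OF det_smooth] unfolding isCont_def by (simp add: order_tendstoD(1))
  then have det_ev: "eventually (\<lambda>y. det (N y) > 0) (nhds x)"
    unfolding eventually_at_filter by (rule eventually_mono) (use det_x in auto)
  define R where "R y = cofactor_inverse (N y)" for y
  have R_smooth: "smooth_near \<A> x (\<lambda>y. R y $ i $ j)" for i j
    unfolding R_def cofactor_inverse_def using det_x
    by (simp, intro smooth_near_divide smooth_near_diff smooth_near_mult N_smooth det_smooth) simp
  have Rx: "R x $ i $ j = (if i = j then 1 / l else 0)" for i j
  proof -
    have "(R x ** N x) $ i $ j = R x $ i $ j * l"
      by (simp add: matrix_matrix_mult_def Nx if_distrib cong: if_cong)
    moreover have "R x ** N x = mat 1" unfolding R_def using det_x by (intro cofactor_inverse_mult) simp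
    ultimately show ?thesis using l by (auto simp: mat_def field_simps)
  qed
  define c where "c y = mat_comb (R y) (B y)" for y
  have c_inner: "c y j \<bullet> a = (\<Sum>k\<in>UNIV. R y $ j $ k * (B y k \<bullet> a))" for y j a
    by (simp add: c_def mat_comb_def inner_sum_left)
  have c_smooth: "smooth_near \<A> x (\<lambda>y. (c y j - v j) \<bullet> a)" for j a
    unfolding inner_diff_left c_inner
    by (intro smooth_near_diff smooth_near_sum smooth_near_mult R_smooth B_smooth smooth_near_const)
  define q where "q j = deriv_along Z (\<lambda>y. c y j - v j)" for j
  have q_inner: "q j \<bullet> a = Z (\<lambda>y. (c y j - v j) \<bullet> a)" for j a
    unfolding q_def by (rule deriv_along_inner[OF Z c_smooth])
  have chart: "eventually (\<lambda>y. graph_chart (Psi \<A> g Q \<mu> x) (Psi \<A> g Q \<mu> y) =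
      (\<lambda>w. \<Sum>j\<in>UNIV. (v j \<bullet> w) *\<^sub>R (c y j - v j))) (nhds x)"
    using B det_ev
  proof eventually_elim
    case (elim y)
    show ?case unfolding Psi_x Psi_eq[OF elim(1)]
      by (rule graph_chart_eq[OF ortho N_def elim(2)]) (simp add: c_def R_def)
  qed
  show ?thesis
  proof (rule that)
    show "grassmann_differential (Psi \<A> g Q \<mu>) x Z = (\<Sum>j\<in>UNIV. tensor (v j) (q j))"
    proof
      fix w
      let ?F = "\<lambda>y. \<Sum>j\<in>UNIV. (v j \<bullet> w) *\<^sub>R (c y j - v j)"
      have F_smooth: "smooth_near \<A> x (\<lambda>y. ?F y \<bullet> a)" for a
        unfolding inner_sum_left inner_scaleR_left
        by (intro smooth_near_sum smooth_near_mult smooth_near_const c_smooth)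
      have "Z (\<lambda>y. graph_chart (Psi \<A> g Q \<mu> x) (Psi \<A> g Q \<mu> y) w \<bullet> b) = Z (\<lambda>y. ?F y \<bullet> b)" for b
        by (rule derivation_cong[OF Z], rule eventually_mono[OF chart]) simp
      then have "grassmann_differential (Psi \<A> g Q \<mu>) x Z w = deriv_along Z ?F"
        unfolding grassmann_differential_def deriv_along_def by simp
      also have "\<dots> = (\<Sum>j\<in>UNIV. (v j \<bullet> w) *\<^sub>R q j)"
      proof -
        have "deriv_along Z ?F \<bullet> a = (\<Sum>j\<in>UNIV. (v j \<bullet> w) *\<^sub>R q j) \<bullet> a" for a
        proof -
          have "deriv_along Z ?F \<bullet> a = Z (\<lambda>y. ?F y \<bullet> a)" by (rule deriv_along_inner[OF Z F_smooth])
          also have "\<dots> = Z (\<lambda>y. \<Sum>j\<in>UNIV. (v j \<bullet> w) * ((c y j - v j) \<bullet> a))"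
            by (simp only: inner_sum_left inner_scaleR_left)
          also have "\<dots> = (\<Sum>j\<in>UNIV. (v j \<bullet> w) * (q j \<bullet> a))"
            unfolding q_inner using c_smooth
            by (simp only: derivation_sum[OF Z] derivation_cmult[OF Z] smooth_near_mult smooth_near_const)
          finally show ?thesis by (simp only: inner_sum_left inner_scaleR_left)
        qed
        then show ?thesis using vector_eq_rdot by blast
      qed
      finally show "grassmann_differential (Psi \<A> g Q \<mu>) x Z w = (\<Sum>j\<in>UNIV. tensor (v j) (q j)) w"
        by (simp add: sum_fun_apply tensor_def)
    qed
    fix j p assume "p \<in> (plane (Psi \<A> g Q \<mu> x))\<^sup>\<bottom>"
    then have vp: "v i \<bullet> p = 0" for i by (simp add: Psi_x plane_oriented_span mem_orthogonal_comp_span)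
    then have Bp: "B x i \<bullet> p = 0" for i by (simp add: Bx)
    have "q j \<bullet> p = Z (\<lambda>y. \<Sum>k\<in>UNIV. R y $ j $ k * (B y k \<bullet> p))"
      unfolding q_inner inner_diff_left vp c_inner by simp
    also have "\<dots> = (\<Sum>k\<in>UNIV. Z (\<lambda>y. R y $ j $ k * (B y k \<bullet> p)))"
      by (rule derivation_sum[OF Z]) (intro smooth_near_mult R_smooth B_smooth)
    also have "\<dots> = (\<Sum>k\<in>UNIV. R x $ j $ k * g x (I k x (K p x)) Z)"
      by (simp add: derivation_mult[OF Z R_smooth B_smooth] Bp B_deriv[OF Z Bp])
    also have "\<dots> = (1 / l) * g x (I j x (K p x)) Z"
      by (simp add: Rx if_distrib[of "\<lambda>c. c * _"] cong: if_cong)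
    finally show "p \<bullet> q j = (1 / l) * g x (I j x (K p x)) Z" by (simp add: inner_commute)
  qed
qed

end

theorem theorem5p2:
  fixes \<A> :: "('m::{t2_space, second_countable_topology}, 'e::euclidean_space) atlas"
    and \<G> :: "('g::{t2_space, second_countable_topology}, 'l::euclidean_space) atlas"
    and g :: "'m metric_tensor"
    and nab :: "'m connection"
    and Q :: "'m \<Rightarrow> 'm tendo set"
    and G :: "'g monoid"
    and \<iota> :: "'l \<Rightarrow> 'g tvec"
    and act :: "'g \<Rightarrow> 'm \<Rightarrow> 'm"
    and \<mu> :: "'l \<Rightarrow> 'm \<Rightarrow> 'm tendo"
    and lam :: "'m \<Rightarrow> real"
    and x :: 'm
    and I :: "3 \<Rightarrow> 'm \<Rightarrow> 'm tendo"
    and v p :: "3 \<Rightarrow> 'l"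
    and Y :: "'m tvec"
  assumes M_connected: "connected (UNIV :: 'm set)"
    and M_qk: "quaternion_kaehler \<A> g nab Q"
    and M_scal: "\<forall>y. scalar_curvature \<A> g nab y \<noteq> 0"
    and G_compact: "compact (UNIV :: 'g set)"
    and G_lie: "lie_group \<G> G"
    and lie_alg: "lie_algebra_identification \<G> G \<iota>"
    and action: "quaternionic_isometric_action \<G> G \<A> g Q act"
    and moment: "moment_map \<A> g nab Q G \<iota> act \<mu>"
    and lam_diff: "differentiable_fun_on \<A> (regular_set \<A> g Q \<mu>) lam"
    and lam_pos: "\<forall>y\<in>regular_set \<A> g Q \<mu>. lam y > 0"
    and lam_inv: "\<forall>h. \<forall>y\<in>regular_set \<A> g Q \<mu>. lam (act h y) = lam y"
    and lam_B: "\<forall>y\<in>regular_set \<A> g Q \<mu>. \<forall>I B. moment_components \<A> g Q \<mu> y I B \<longrightarrow>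
                  (\<exists>w. oriented_orthonormal_basis (Psi \<A> g Q \<mu> y) w \<and> (\<forall>i. B i = lam y *\<^sub>R w i))"
    and x: "x \<in> regular_set \<A> g Q \<mu>"
    and v: "oriented_orthonormal_basis (Psi \<A> g Q \<mu> x) v"
    and mu_x: "moment_components \<A> g Q \<mu> x I (\<lambda>i. lam x *\<^sub>R v i)"
    and Y: "Y \<in> tangent_space \<A> x"
    and p: "\<forall>i. p i \<in> (plane (Psi \<A> g Q \<mu> x))\<^sup>\<bottom>"
    and Psi_Y: "grassmann_differential (Psi \<A> g Q \<mu>) x Y = (\<Sum>i\<in>UNIV. tensor (v i) (p i))"
  shows "natural_endo \<A> g (Psi \<A> g Q \<mu>) x Y =
           (1 / lam x) *\<^sub>R (\<Sum>i\<in>UNIV. I i x (killing_field \<A> G \<iota> act (p i) x))"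
proof -
  interpret quaternionic_moment \<A> nab g Q \<mu> "killing_field \<A> G \<iota> act"
  proof (intro quaternionic_moment.intro affine_manifold.intro smooth_manifold.intro
      affine_manifold_axioms.intro quaternionic_moment_axioms.intro)
    show "smooth_atlas \<A>" "riemannian_metric \<A> g" using M_qk unfolding quaternion_kaehler_def by blast+
    show "affine_connection \<A> nab" using M_qk unfolding quaternion_kaehler_def levi_civita_def by blast
    show "linear (\<lambda>a. \<mu> a y)" "smooth_endo_on \<A> UNIV (\<mu> a)" "\<mu> a y \<in> Q y" for a y
      using moment unfolding moment_map_def by blast+
    show "has_cov_deriv \<A> nab (\<mu> a) y D (\<Sum>i\<in>UNIV. g y (J i y (killing_field \<A> G \<iota> act a y)) D *\<^sub>R J i y)"
      if "quaternionic_frame \<A> g Q W J" "y \<in> W" "D \<in> tangent_space \<A> y" for a y D W J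
      using moment that unfolding moment_map_def by blast
  qed
  let ?R = "(1 / lam x) *\<^sub>R (\<Sum>i\<in>UNIV. I i x (killing_field \<A> G \<iota> act (p i) x))"
  have ortho: "v i \<bullet> v j = (if i = j then 1 else 0)" for i j
    using v unfolding oriented_orthonormal_basis_def by blast
  have l: "lam x > 0" using lam_pos x by blast
  obtain W where W: "x \<in> W" "quaternionic_frame \<A> g Q W I"
    using mu_x unfolding moment_components_def by blast
  interpret T: quaternionic_space "tangent_space \<A> x" "g x" "\<lambda>i. I i x"
    by (rule frame_quaternionic_space[OF W(2,1)])
  have closed: "I i x u \<in> tangent_space \<A> x" for i u by (rule frame_closed[OF W(2,1)])
  then have R: "?R \<in> tangent_space \<A> x" by (intro tangent_scale tangent_sum)
  have gR: "g x ?R Z = grassmann_metric (grassmann_differential (Psi \<A> g Q \<mu>) x Y)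
      (grassmann_differential (Psi \<A> g Q \<mu>) x Z)" if Z: "Z \<in> tangent_space \<A> x" for Z
  proof -
    obtain q where q: "grassmann_differential (Psi \<A> g Q \<mu>) x Z = (\<Sum>j\<in>UNIV. tensor (v j) (q j))"
      "\<And>j p. p \<in> (plane (Psi \<A> g Q \<mu> x))\<^sup>\<bottom> \<Longrightarrow>
        p \<bullet> q j = (1 / lam x) * g x (I j x (killing_field \<A> G \<iota> act p x)) Z"
      by (rule Psi_differential[OF mu_x l ortho Z]) blast
    have "g x ?R Z = (\<Sum>i\<in>UNIV. (1 / lam x) * g x (I i x (killing_field \<A> G \<iota> act (p i) x)) Z)"
      unfolding scaleR_sum_right using closed by (intro T.metric_sum Z)
    also have "\<dots> = (\<Sum>i\<in>UNIV. p i \<bullet> q i)" using q(2) p by simp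
    finally show ?thesis unfolding Psi_Y q(1) grassmann_metric_tensor_sum[OF ortho] .
  qed
  show ?thesis
    unfolding natural_endo_def sharp_def
  proof (rule the_equality)
    fix Z assume "Z \<in> tangent_space \<A> x \<and> (\<forall>X\<in>tangent_space \<A> x. g x Z X =
      grassmann_metric (grassmann_differential (Psi \<A> g Q \<mu>) x Y) (grassmann_differential (Psi \<A> g Q \<mu>) x X))"
    then have Z: "Z \<in> tangent_space \<A> x" and eq: "\<And>X. X \<in> tangent_space \<A> x \<Longrightarrow> g x Z X = g x ?R X"
      using gR by auto
    have d: "Z - ?R \<in> tangent_space \<A> x" using Z R by (rule tangent_diff)
    have "g x (Z - ?R) (Z - ?R) = 0"
      using T.metric_add[OF d R d] eq[OF d] by simp
    then show "Z = ?R" using T.metric_pos[OF d] by auto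
  qed (use R gR in auto)
qed

end
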